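(* Let $\varphi\in L^1_{\rm loc}([0,\infty))$ with $\sup_{x\ge0}\int_x^{x+1}|\varphi|<\infty$, let $\lambda\in\mathbb R$, and let $c_\pm=3\pm\sqrt8$. For $\xi\in\partial\mathbb D$ and $L>0$ define $\epsilon=\epsilon(\xi,L)>0$ by $\|A+\xi B\|_L\,\|A-\xi B\|_L=\frac1{2\epsilon}$. Then $$c_-\frac{\|A-\xi B\|_L}{\|A+\xi B\|_L}\le\left|\frac{1+\xi s(\lambda+i\epsilon(\xi,L))}{1-\xi s(\lambda+i\epsilon(\xi,L))}\right|\le c_+\frac{\|A-\xi B\|_L}{\|A+\xi B\|_L}.$$ In particular, $\lim_{\epsilon\downarrow0}s(\lambda+i\epsilon)=\overline\xi$ if and only if the solution $W$ of $\Lambda_\varphi W=\lambda W$ with $W(0)=(1,\xi)^\top$ is subordinate at $+\infty$.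
   Context: $\Lambda_\varphi=\begin{bmatrix} i&0\\0&-i\end{bmatrix}\frac{d}{dx}+\begin{bmatrix}0&\varphi\\ \overline{\varphi}&0\end{bmatrix}$ on $[0,\infty)$. For $\Im z>0$, the Weyl solution $\Psi(z,\cdot)$ is the (unique up to scalar) solution of $\Lambda_\varphi\Psi=z\Psi$ in $L^2([0,\infty),\mathbb C^2)$, normalized $\Psi(z,0)=(s(z),1)^\top$; $s$ is the Schur function. $T(\lambda,x)$ is the solution of $\Lambda_\varphi T=\lambda T$, $T(\lambda,0)=I$; for real $\lambda$ it lies in $SU(1,1)$ and is written $T(\lambda,x)=\begin{bmatrix}A(\lambda,x)&B(\lambda,x)\\ \overline{B(\lambda,x)}&\overline{A(\lambda,x)}\end{bmatrix}$. $\|f\|_L=(\int_0^L|f|^2)^{1/2}$. A solution $V$ of $\Lambda_\varphi V=\lambda V$ is subordinate at $+\infty$ if $\|U\|_L/\|V\|_L\to\infty$ as $L\to\infty$ for every solution $U$ linearly independent of $V$. *)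

theory Defs
  imports "HOL-Analysis.Analysis"
begin

text \<open>Dirac system  Lambda_phi Y = z Y  on [0,oo), written in integral form:
  Y1' = i (phi Y2 - z Y1),  Y2' = i (z Y2 - conj(phi) Y1).
  For x < 0 the interval {0..x} is empty, so the equation forces Y x = Y 0 there;
  this normalises solutions off [0,oo) and makes them unique.\<close>

definition dirac_rhs :: "(real \<Rightarrow> complex) \<Rightarrow> complex \<Rightarrow> (real \<Rightarrow> complex \<times> complex) \<Rightarrow> real \<Rightarrow> complex \<times> complex" where
  "dirac_rhs \<phi> z Y t =
     (\<i> * (\<phi> t * snd (Y t) - z * fst (Y t)),
      \<i> * (z * snd (Y t) - cnj (\<phi> t) * fst (Y t)))"

definition is_sol :: "(real \<Rightarrow> complex) \<Rightarrow> complex \<Rightarrow> (real \<Rightarrow> complex \<times> complex) \<Rightarrow> bool" where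
  "is_sol \<phi> z Y \<longleftrightarrow> (\<forall>x. (dirac_rhs \<phi> z Y has_integral (Y x - Y 0)) {0..x})"

definition sol :: "(real \<Rightarrow> complex) \<Rightarrow> complex \<Rightarrow> complex \<times> complex \<Rightarrow> real \<Rightarrow> complex \<times> complex" where
  "sol \<phi> z v = (THE Y. is_sol \<phi> z Y \<and> Y 0 = v)"

text \<open>Entries of the transfer matrix T(lambda,x) = [[A,B],[conj B, conj A]]:
  first column is the solution with T(0) e1 = (1,0), second with (0,1).\<close>
definition Aent :: "(real \<Rightarrow> complex) \<Rightarrow> real \<Rightarrow> real \<Rightarrow> complex" where
  "Aent \<phi> lam x = fst (sol \<phi> (complex_of_real lam) (1, 0) x)"

definition Bent :: "(real \<Rightarrow> complex) \<Rightarrow> real \<Rightarrow> real \<Rightarrow> complex" where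
  "Bent \<phi> lam x = fst (sol \<phi> (complex_of_real lam) (0, 1) x)"

definition schur :: "(real \<Rightarrow> complex) \<Rightarrow> complex \<Rightarrow> complex" where
  "schur \<phi> z = (THE s. \<exists>\<Psi>. is_sol \<phi> z \<Psi> \<and> \<Psi> 0 = (s, 1) \<and>
                       (\<lambda>x. (norm (\<Psi> x))\<^sup>2) integrable_on {0..})"

definition normL :: "real \<Rightarrow> (real \<Rightarrow> 'a::real_normed_vector) \<Rightarrow> real" where
  "normL L f = sqrt (integral {0..L} (\<lambda>x. (norm (f x))\<^sup>2))"

definition lin_indep_sol :: "(real \<Rightarrow> complex \<times> complex) \<Rightarrow> (real \<Rightarrow> complex \<times> complex) \<Rightarrow> bool" where
  "lin_indep_sol U V \<longleftrightarrow> (\<forall>a b::complex. (\<forall>x\<ge>0. a * fst (U x) + b * fst (V x) = 0 \<and>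
                                            a * snd (U x) + b * snd (V x) = 0) \<longrightarrow> a = 0 \<and> b = 0)"

definition subordinate :: "(real \<Rightarrow> complex) \<Rightarrow> real \<Rightarrow> (real \<Rightarrow> complex \<times> complex) \<Rightarrow> bool" where
  "subordinate \<phi> lam V \<longleftrightarrow> is_sol \<phi> (complex_of_real lam) V \<and>
     (\<forall>U. is_sol \<phi> (complex_of_real lam) U \<and> lin_indep_sol U V \<longrightarrow>
        filterlim (\<lambda>L. normL L U / normL L V) at_top at_top)"

end

theory Submission
  imports Defs
begin

text \<open>Write \<open>p = A + \<xi> B\<close>, \<open>m = A - \<xi> B\<close>. Expand the initial value \<open>(s, 1)\<close> of the Weyl solution \<open>\<Psi>\<close> in the
  vectors \<open>(1, \<xi>)\<close> and \<open>(1, - \<xi>)\<close> with coefficients \<open>\<alpha>\<close> and \<open>\<beta>\<close>; the Cayley transform in the theorem has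
  modulus \<open>|\<alpha>| / |\<beta>|\<close>. Variation of constants compares \<open>\<Psi>\<close> at \<open>\<lambda> + i \<epsilon>\<close> with the combination
  \<open>\<Phi>\<close> at \<open>\<lambda>\<close> having the same initial value: \<open>\<Psi> - \<Phi>\<close> is a Volterra operator applied to \<open>\<Psi>\<close>, whose
  Hilbert--Schmidt norm on \<open>[0, L]\<close> is at most \<open>\<epsilon> \<parallel>p\<parallel> \<parallel>m\<parallel> = 1/2\<close>. Together with the energy
  bound \<open>2 \<epsilon> \<parallel>\<Psi>\<parallel>\<^sup>2 \<le> 1 - |s|\<^sup>2\<close> this gives \<open>X\<^sup>2 + Y\<^sup>2 \<le> 6 X Y\<close> for
  \<open>X = |\<alpha>| \<parallel>p\<parallel>\<close>, \<open>Y = |\<beta>| \<parallel>m\<parallel>\<close>, which is the two-sided bound with \<open>3 \<plusminus> \<surd>8\<close>.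
  For the equivalence, \<open>\<parallel>p\<parallel> \<parallel>m\<parallel>\<close> is continuous and increasing in \<open>L\<close> and at least \<open>L\<close>, so
  \<open>\<epsilon> \<rightarrow> 0\<close> and \<open>L \<rightarrow> \<infinity>\<close> are interchangeable.\<close>

section \<open>Products of indefinite integrals\<close>

lemma absolutely_integrable_continuous_mult:
  fixes f g :: "real \<Rightarrow> 'a::{euclidean_space,real_normed_algebra}"
  assumes f: "f absolutely_integrable_on {a..b}" and g: "continuous_on {a..b} g"
  shows "(\<lambda>t. f t * g t) absolutely_integrable_on {a..b}"
    and "(\<lambda>t. g t * f t) absolutely_integrable_on {a..b}"
proof -
  have m: "g \<in> borel_measurable (lebesgue_on {a..b})"
    using g by (intro continuous_imp_measurable_on_sets_lebesgue) auto
  have bd: "bounded (g ` {a..b})"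
    using g by (intro compact_imp_bounded compact_continuous_image) auto
  have bl: "bilinear ((*) :: 'a \<Rightarrow> 'a \<Rightarrow> 'a)" "bilinear (\<lambda>x y::'a. y * x)"
    by (auto simp: bilinear_conv_bounded_bilinear bounded_bilinear_mult
        intro: bounded_bilinear.flip[OF bounded_bilinear_mult])
  show "(\<lambda>t. g t * f t) absolutely_integrable_on {a..b}"
    using absolutely_integrable_bounded_measurable_product[OF bl(1) m _ bd f] by simp
  show "(\<lambda>t. f t * g t) absolutely_integrable_on {a..b}"
    using absolutely_integrable_bounded_measurable_product[OF bl(2) m _ bd f] by simp
qed

text \<open>Stands in for "zero derivative implies constant" when derivatives exist only almost
  everywhere. Telescoping over a partition of mesh below d bounds the total increment by e * (M b -
  M a), and e is arbitrary.\<close>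

lemma increments_dominated_imp_eq:
  fixes H :: "real \<Rightarrow> 'a::real_normed_vector" and M :: "real \<Rightarrow> real"
  assumes "a \<le> b"
    and dom: "\<And>e. e > 0 \<Longrightarrow> \<exists>d>0. \<forall>u v. a \<le> u \<and> u \<le> v \<and> v \<le> b \<and> v - u < d
                \<longrightarrow> norm (H v - H u) \<le> e * (M v - M u)"
  shows "H b = H a"
proof -
  have bound: "norm (H b - H a) \<le> e * (M b - M a)" if e: "e > 0" for e
  proof -
    obtain d where "d > 0" and d: "\<And>u v. \<lbrakk>a \<le> u; u \<le> v; v \<le> b; v - u < d\<rbrakk>
        \<Longrightarrow> norm (H v - H u) \<le> e * (M v - M u)"
      using dom[OF e] by auto
    obtain n :: nat where n: "(b - a) / d < real n"
      using reals_Archimedean2 by blast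
    have "n > 0"
      using n \<open>a \<le> b\<close> \<open>d > 0\<close> by (cases n) (auto simp: divide_less_0_iff not_less field_simps)
    define h where "h = (b - a) / n"
    have h: "0 \<le> h" "h < d" "n * h = b - a"
      using n \<open>n > 0\<close> \<open>a \<le> b\<close> \<open>d > 0\<close> by (auto simp: h_def field_simps)
    have "norm (H (a + k * h) - H a) \<le> e * (M (a + k * h) - M a)" if "k \<le> n" for k :: nat
      using that
    proof (induction k)
      case 0
      then show ?case by simp
    next
      case (Suc k)
      have le: "Suc k * h \<le> n * h"
        using Suc.prems h by (intro mult_right_mono) auto
      have "norm (H (a + Suc k * h) - H (a + k * h)) \<le> e * (M (a + Suc k * h) - M (a + k * h))"
        using h le by (intro d) (auto simp: algebra_simps)
      moreover have "norm (H (a + k * h) - H a) \<le> e * (M (a + k * h) - M a)"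
        using Suc by simp
      moreover have "norm (H (a + Suc k * h) - H a)
          \<le> norm (H (a + Suc k * h) - H (a + k * h)) + norm (H (a + k * h) - H a)"
        using norm_triangle_ineq[of "H (a + Suc k * h) - H (a + k * h)" "H (a + k * h) - H a"] by simp
      ultimately show ?case by (simp add: algebra_simps)
    qed
    from this[of n] h \<open>n > 0\<close> show ?thesis by simp
  qed
  have "norm (H b - H a) \<le> 0 * (M b - M a)"
  proof (rule tendsto_lowerbound)
    show "((\<lambda>e. e * (M b - M a)) \<longlongrightarrow> 0 * (M b - M a)) (at_right 0)"
      by (intro tendsto_intros)
    show "\<forall>\<^sub>F e in at_right 0. norm (H b - H a) \<le> e * (M b - M a)"
      using bound by (auto simp: eventually_at_right_less intro: eventually_mono[OF eventually_at_right_less])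
  qed auto
  then show ?thesis by simp
qed

lemma continuous_on_of_has_integral:
  fixes f F :: "real \<Rightarrow> 'a::banach"
  assumes "\<And>x. x \<in> {a..b} \<Longrightarrow> (f has_integral F x - F a) {a..x}"
  shows "continuous_on {a..b} F"
proof (cases "a \<le> b")
  case True
  have "continuous_on {a..b} (\<lambda>x. F a + integral {a..x} f)"
    using assms[of b] True
    by (intro continuous_intros indefinite_integral_continuous_1) (auto simp: integrable_on_def)
  then show ?thesis
  proof (rule continuous_on_eq)
    show "F a + integral {a..x} f = F x" if "x \<in> {a..b}" for x
      using integral_unique[OF assms[OF that]] by simp
  qed
qed auto

lemma has_integral_transform:
  "(f has_integral y) S \<Longrightarrow> (\<And>x. x \<in> S \<Longrightarrow> f x = g x) \<Longrightarrow> y = z \<Longrightarrow> (g has_integral z) S"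
  by (metis has_integral_eq)

lemma has_integral_subinterval:
  fixes f F :: "real \<Rightarrow> 'a::banach"
  assumes F: "\<And>x. x \<in> {a..b} \<Longrightarrow> (f has_integral F x - F a) {a..x}"
    and "a \<le> u" "u \<le> v" "v \<le> b"
  shows "(f has_integral F v - F u) {u..v}"
proof -
  have int: "f integrable_on {a..v}" using F[of v] assms(2-) by (auto simp: integrable_on_def)
  then have "f integrable_on {u..v}"
    by (rule integrable_subinterval_real) (use assms in auto)
  moreover have "integral {a..u} f + integral {u..v} f = integral {a..v} f"
    using int assms by (intro Henstock_Kurzweil_Integration.integral_combine) auto
  moreover have "integral {a..u} f = F u - F a" "integral {a..v} f = F v - F a"
    using F assms by (auto intro: integral_unique)
  ultimately show ?thesis
    by (simp add: has_integral_iff algebra_simps)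
qed

text \<open>\<open>F\<close> and \<open>G\<close> are primitives of integrable functions, hence need
  not be differentiable everywhere. Uniform continuity makes the increments of the defect
  \<open>H\<close> small relative to those of \<open>M\<close>, the integral of the norms, so
  \<open>H\<close> takes the same value at both ends.\<close>

lemma has_integral_product_rule:
  fixes f g F G :: "real \<Rightarrow> 'a::{euclidean_space,real_normed_algebra}"
  assumes "a \<le> b"
    and f: "f absolutely_integrable_on {a..b}" and g: "g absolutely_integrable_on {a..b}"
    and F: "\<And>x. x \<in> {a..b} \<Longrightarrow> (f has_integral F x - F a) {a..x}"
    and G: "\<And>x. x \<in> {a..b} \<Longrightarrow> (g has_integral G x - G a) {a..x}"
  shows "((\<lambda>t. f t * G t + F t * g t) has_integral F b * G b - F a * G a) {a..b}"
proof -
  note cF = continuous_on_of_has_integral[OF F] and cG = continuous_on_of_has_integral[OF G]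
  let ?k = "\<lambda>t. f t * G t + F t * g t" and ?m = "\<lambda>t. norm (f t) + norm (g t)"
  have k: "?k integrable_on {a..b}"
    using f g cF cG by (intro integrable_add absolutely_integrable_continuous_mult
        set_lebesgue_integral_eq_integral(1)) auto
  have m: "?m integrable_on {a..b}"
    using f g by (intro integrable_add) (auto simp: absolutely_integrable_on_def)
  define H where "H x = F x * G x - integral {a..x} ?k" for x
  define M where "M x = integral {a..x} ?m" for x
  have "H b = H a"
  proof (rule increments_dominated_imp_eq[OF \<open>a \<le> b\<close>, where M = M])
    fix e :: real assume "e > 0"
    have "uniformly_continuous_on {a..b} F" "uniformly_continuous_on {a..b} G"
      using cF cG by (auto intro: compact_uniformly_continuous)
    then obtain d1 d2 where "d1 > 0" "d2 > 0"
      and d1: "\<And>x y. \<lbrakk>x \<in> {a..b}; y \<in> {a..b}; dist y x < d1\<rbrakk> \<Longrightarrow> dist (F y) (F x) < e"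
      and d2: "\<And>x y. \<lbrakk>x \<in> {a..b}; y \<in> {a..b}; dist y x < d2\<rbrakk> \<Longrightarrow> dist (G y) (G x) < e"
      using \<open>e > 0\<close> unfolding uniformly_continuous_on_def by metis
    show "\<exists>d>0. \<forall>u v. a \<le> u \<and> u \<le> v \<and> v \<le> b \<and> v - u < d \<longrightarrow> norm (H v - H u) \<le> e * (M v - M u)"
    proof (intro exI[of _ "min d1 d2"] conjI allI impI; (elim conjE)?)
      fix u v assume uv: "a \<le> u" "u \<le> v" "v \<le> b" "v - u < min d1 d2"
      have k1: "(?k has_integral integral {a..v} ?k - integral {a..u} ?k) {u..v}"
        by (rule has_integral_subinterval[where F = "\<lambda>x. integral {a..x} ?k" and a = a and b = b])
          (use uv k in \<open>auto intro!: integrable_integral integrable_subinterval_real[OF k]\<close>)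
      have m1: "(?m has_integral M v - M u) {u..v}" unfolding M_def
        by (rule has_integral_subinterval[where F = "\<lambda>x. integral {a..x} ?m" and a = a and b = b])
          (use uv m in \<open>auto intro!: integrable_integral integrable_subinterval_real[OF m]\<close>)
      have f1: "(f has_integral F v - F u) {u..v}" and g1: "(g has_integral G v - G u) {u..v}"
        using has_integral_subinterval[of a b f F u v, OF F] has_integral_subinterval[of a b g G u v, OF G]
          uv by blast+
      \<comment> \<open>The increment of the product is split with \<open>G\<close> frozen at the
        right end and \<open>F\<close> at the left end. The order of the factors is kept, as
        multiplication need not commute.\<close>
      have "((\<lambda>t. f t * G v + F u * g t - ?k t) has_integral
          (F v - F u) * G v + F u * (G v - G u) - (integral {a..v} ?k - integral {a..u} ?k)) {u..v}"
        by (intro has_integral_diff has_integral_add k1 has_integral_mult_left f1 has_integral_mult_right g1)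
      moreover have "(F v - F u) * G v + F u * (G v - G u) - (integral {a..v} ?k - integral {a..u} ?k)
          = H v - H u"
        by (simp add: H_def algebra_simps)
      ultimately have eq: "((\<lambda>t. f t * G v + F u * g t - ?k t) has_integral H v - H u) {u..v}" by simp
      have "norm (integral {u..v} (\<lambda>t. f t * G v + F u * g t - ?k t)) \<le> integral {u..v} (\<lambda>t. e * ?m t)"
      proof (rule integral_norm_bound_integral)
        fix t assume t: "t \<in> {u..v}"
        have "norm (G v - G t) \<le> e" "norm (F u - F t) \<le> e"
          using uv t d1[of t u] d2[of t v] by (auto simp: dist_norm intro!: less_imp_le)
        then have "norm (f t * (G v - G t)) \<le> norm (f t) * e" "norm ((F u - F t) * g t) \<le> e * norm (g t)"
          by (auto intro!: order_trans[OF norm_mult_ineq] mult_left_mono mult_right_mono)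
        moreover have "f t * G v + F u * g t - ?k t = f t * (G v - G t) + (F u - F t) * g t"
          by (simp add: algebra_simps)
        ultimately show "norm (f t * G v + F u * g t - ?k t) \<le> e * ?m t"
          by (smt (verit) norm_triangle_ineq distrib_left mult.commute)
      qed (use eq has_integral_mult_right[OF m1, of e] in \<open>auto simp: integrable_on_def\<close>)
      then show "norm (H v - H u) \<le> e * (M v - M u)"
        using eq m1 by (simp add: integral_unique)
    qed (use \<open>d1 > 0\<close> \<open>d2 > 0\<close> in auto)
  qed
  then show ?thesis
    using k by (simp add: H_def has_integral_iff algebra_simps)
qed

text \<open>Induction with the product rule for \<open>F\<close> and
  \<open>F ^ Suc n / Suc n\<close>. The hypothesis at the point a is an integral over one point and
  so forces \<open>F a = 0\<close>.\<close>

lemma has_integral_power_rule: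
  fixes f F :: "real \<Rightarrow> real"
  assumes f: "f absolutely_integrable_on {a..b}"
    and F: "\<And>x. x \<in> {a..b} \<Longrightarrow> (f has_integral F x) {a..x}"
    and "x \<in> {a..b}"
  shows "((\<lambda>t. f t * F t ^ n) has_integral F x ^ Suc n / Suc n) {a..x}"
  using \<open>x \<in> {a..b}\<close>
proof (induction n arbitrary: x)
  case 0
  then show ?case using F by simp
next
  case (Suc n)
  have "F a = 0" using F[of a] Suc.prems by (auto dest: has_integral_unique[OF _ has_integral_refl(2)])
  then have F': "(f has_integral F y - F a) {a..y}" if "y \<in> {a..b}" for y
    using F[OF that] by simp
  have c: "continuous_on {a..b} F" by (rule continuous_on_of_has_integral[OF F'])
  have "((\<lambda>t. f t * (F t ^ Suc n / Suc n) + F t * (f t * F t ^ n)) has_integral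
      F x * (F x ^ Suc n / Suc n) - F a * (F a ^ Suc n / Suc n)) {a..x}"
  proof (rule has_integral_product_rule)
    show "f absolutely_integrable_on {a..x}"
      by (rule absolutely_integrable_on_subinterval[OF f]) (use Suc.prems in auto)
    then show "(\<lambda>t. f t * F t ^ n) absolutely_integrable_on {a..x}"
      using Suc.prems by (intro absolutely_integrable_continuous_mult continuous_intros
          continuous_on_subset[OF c]) auto
  qed (use Suc F' \<open>F a = 0\<close> in auto)
  \<comment> \<open>Both summands are multiples of \<open>f t * F t ^ Suc n\<close>, and 1/(n+1) + 1
    = (n+2)/(n+1).\<close>
  then have "((\<lambda>t. (real (Suc (Suc n)) / Suc n) * (f t * F t ^ Suc n)) has_integral
      F x ^ Suc (Suc n) / Suc n) {a..x}"
    by (rule has_integral_transform) (auto simp: \<open>F a = 0\<close> field_simps)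
  from has_integral_mult_right[OF this, of "real (Suc n) / Suc (Suc n)"]
  show ?case by (simp add: field_simps del: of_nat_Suc power_Suc)
qed

section \<open>Solutions of the Dirac system\<close>

lemma has_integral_Pair_iff:
  fixes f :: "'a::euclidean_space \<Rightarrow> 'b::euclidean_space \<times> 'c::euclidean_space"
  shows "(f has_integral y) S \<longleftrightarrow>
    ((\<lambda>x. fst (f x)) has_integral fst y) S \<and> ((\<lambda>x. snd (f x)) has_integral snd y) S"
proof
  assume "(f has_integral y) S"
  then show "((\<lambda>x. fst (f x)) has_integral fst y) S \<and> ((\<lambda>x. snd (f x)) has_integral snd y) S"
    using has_integral_linear[OF _ bounded_linear_fst, of f y S]
      has_integral_linear[OF _ bounded_linear_snd, of f y S] by (auto simp: o_def)
next
  assume *: "((\<lambda>x. fst (f x)) has_integral fst y) S \<and> ((\<lambda>x. snd (f x)) has_integral snd y) S"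
  have bl: "bounded_linear (\<lambda>x::'b. (x, 0::'c))" "bounded_linear (\<lambda>x::'c. (0::'b, x))"
    by (auto intro!: bounded_linear_Pair bounded_linear_zero bounded_linear_ident)
  have "((\<lambda>x. (fst (f x), 0) + (0, snd (f x))) has_integral (fst y, 0) + (0, snd y)) S"
    using * has_integral_linear[OF _ bl(1)] has_integral_linear[OF _ bl(2)]
    by (intro has_integral_add) (auto simp: o_def)
  then show "(f has_integral y) S" by simp
qed

lemma is_sol_iff:
  "is_sol \<phi> z Y \<longleftrightarrow> (\<forall>x.
     ((\<lambda>t. \<i> * (\<phi> t * snd (Y t) - z * fst (Y t))) has_integral fst (Y x) - fst (Y 0)) {0..x} \<and>
     ((\<lambda>t. \<i> * (z * snd (Y t) - cnj (\<phi> t) * fst (Y t))) has_integral snd (Y x) - snd (Y 0)) {0..x})"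
  by (simp add: is_sol_def has_integral_Pair_iff dirac_rhs_def)

section \<open>Linear structure and conjugation symmetry of the solution space\<close>

lemma is_sol_add: "is_sol \<phi> z U \<Longrightarrow> is_sol \<phi> z V \<Longrightarrow> is_sol \<phi> z (\<lambda>x. U x + V x)"
  unfolding is_sol_def
proof
  fix x
  assume *: "\<forall>x. (dirac_rhs \<phi> z U has_integral U x - U 0) {0..x}"
    "\<forall>x. (dirac_rhs \<phi> z V has_integral V x - V 0) {0..x}"
  have "((\<lambda>t. dirac_rhs \<phi> z U t + dirac_rhs \<phi> z V t) has_integral U x - U 0 + (V x - V 0)) {0..x}"
    using * by (intro has_integral_add) auto
  then show "(dirac_rhs \<phi> z (\<lambda>x. U x + V x) has_integral U x + V x - (U 0 + V 0)) {0..x}"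
    by (rule has_integral_transform) (simp_all add: dirac_rhs_def algebra_simps)
qed

lemma is_sol_scale:
  assumes "is_sol \<phi> z U"
  shows "is_sol \<phi> z (\<lambda>x. (c * fst (U x), c * snd (U x)))"
  unfolding is_sol_iff
proof (intro allI conjI)
  fix x
  have 1: "((\<lambda>t. \<i> * (\<phi> t * snd (U t) - z * fst (U t))) has_integral fst (U x) - fst (U 0)) {0..x}"
    and 2: "((\<lambda>t. \<i> * (z * snd (U t) - cnj (\<phi> t) * fst (U t))) has_integral snd (U x) - snd (U 0)) {0..x}"
    using assms by (auto simp: is_sol_iff)
  show "((\<lambda>t. \<i> * (\<phi> t * snd (c * fst (U t), c * snd (U t)) - z * fst (c * fst (U t), c * snd (U t))))
      has_integral fst (c * fst (U x), c * snd (U x)) - fst (c * fst (U 0), c * snd (U 0))) {0..x}"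
    using has_integral_mult_right[OF 1, of c]
    by (rule has_integral_transform) (auto simp: algebra_simps)
  show "((\<lambda>t. \<i> * (z * snd (c * fst (U t), c * snd (U t)) - cnj (\<phi> t) * fst (c * fst (U t), c * snd (U t))))
      has_integral snd (c * fst (U x), c * snd (U x)) - snd (c * fst (U 0), c * snd (U 0))) {0..x}"
    using has_integral_mult_right[OF 2, of c]
    by (rule has_integral_transform) (auto simp: algebra_simps)
qed

text \<open>The symmetry behind SU(1,1). For real z it maps the solution space to itself and relates
  the two components; for nonreal z, pairing a solution with its image turns the Wronskian into an
  energy.\<close>

lemma is_sol_cnj_swap:
  assumes "is_sol \<phi> z Y"
  shows "is_sol \<phi> (cnj z) (\<lambda>x. (cnj (snd (Y x)), cnj (fst (Y x))))"
  unfolding is_sol_iff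
proof (intro allI conjI)
  fix x
  have 1: "((\<lambda>t. \<i> * (\<phi> t * snd (Y t) - z * fst (Y t))) has_integral fst (Y x) - fst (Y 0)) {0..x}"
    and 2: "((\<lambda>t. \<i> * (z * snd (Y t) - cnj (\<phi> t) * fst (Y t))) has_integral snd (Y x) - snd (Y 0)) {0..x}"
    using assms by (auto simp: is_sol_iff)
  show "((\<lambda>t. \<i> * (\<phi> t * snd (cnj (snd (Y t)), cnj (fst (Y t))) - cnj z * fst (cnj (snd (Y t)), cnj (fst (Y t)))))
      has_integral fst (cnj (snd (Y x)), cnj (fst (Y x))) - fst (cnj (snd (Y 0)), cnj (fst (Y 0)))) {0..x}"
    using has_integral_linear[OF 2 bounded_linear_cnj]
    by (rule has_integral_transform) (auto simp: algebra_simps)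
  show "((\<lambda>t. \<i> * (cnj z * snd (cnj (snd (Y t)), cnj (fst (Y t))) - cnj (\<phi> t) * fst (cnj (snd (Y t)), cnj (fst (Y t)))))
      has_integral snd (cnj (snd (Y x)), cnj (fst (Y x))) - snd (cnj (snd (Y 0)), cnj (fst (Y 0)))) {0..x}"
    using has_integral_linear[OF 1 bounded_linear_cnj]
    by (rule has_integral_transform) (auto simp: algebra_simps)
qed

lemma continuous_on_is_sol: "is_sol \<phi> z Y \<Longrightarrow> continuous_on {0..b} Y"
  by (rule continuous_on_of_has_integral) (auto simp: is_sol_def)

text \<open>The right-hand side depends on \<open>Y\<close> only through its value at t. This lets
  facts about a linear map of that value, such as limits and finite sums, be applied for fixed
  t.\<close>

lemma dirac_rhs_const: "dirac_rhs \<phi> z Y t = dirac_rhs \<phi> z (\<lambda>_. Y t) t"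
  by (simp add: dirac_rhs_def)

text \<open>The z part and the \<phi> part each scale the Euclidean norm exactly, by the moduli of z
  and \<phi>.\<close>

lemma norm_dirac_rhs_le: "norm (dirac_rhs \<phi> z Y t) \<le> (cmod z + cmod (\<phi> t)) * norm (Y t)"
proof -
  have "dirac_rhs \<phi> z Y t = (- (\<i> * z * fst (Y t)), \<i> * z * snd (Y t))
      + (\<i> * \<phi> t * snd (Y t), - (\<i> * cnj (\<phi> t) * fst (Y t)))"
    by (simp add: dirac_rhs_def algebra_simps)
  also have "norm \<dots> \<le> cmod z * norm (Y t) + cmod (\<phi> t) * norm (Y t)"
  proof (rule order_trans[OF norm_triangle_ineq add_mono])
    have "norm (- (\<i> * z * fst (Y t)), \<i> * z * snd (Y t)) = cmod z * norm (Y t)"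
      by (simp add: norm_prod_def norm_mult power_mult_distrib real_sqrt_mult flip: distrib_left)
    then show "norm (- (\<i> * z * fst (Y t)), \<i> * z * snd (Y t)) \<le> cmod z * norm (Y t)" by simp
    have "norm (\<i> * \<phi> t * snd (Y t), - (\<i> * cnj (\<phi> t) * fst (Y t))) = cmod (\<phi> t) * norm (Y t)"
      by (simp add: norm_prod_def norm_mult power_mult_distrib real_sqrt_mult add.commute flip: distrib_left)
    then show "norm (\<i> * \<phi> t * snd (Y t), - (\<i> * cnj (\<phi> t) * fst (Y t))) \<le> cmod (\<phi> t) * norm (Y t)" by simp
  qed
  finally show ?thesis by (simp add: algebra_simps)
qed

lemma bounded_linear_dirac_rhs: "bounded_linear (\<lambda>w. dirac_rhs \<phi> z (\<lambda>_. w) t)"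
proof (rule bounded_linear_intro)
  show "norm (dirac_rhs \<phi> z (\<lambda>_. w) t) \<le> norm w * (cmod z + cmod (\<phi> t))" for w
    using norm_dirac_rhs_le[of \<phi> z "\<lambda>_. w" t] by (simp add: mult.commute)
qed (auto simp: dirac_rhs_def algebra_simps scaleR_conv_of_real)

section \<open>Existence and uniqueness by Picard iteration\<close>

locale dirac_system =
  fixes \<phi> :: "real \<Rightarrow> complex"
  assumes locally_integrable: "\<And>x. \<phi> absolutely_integrable_on {0..x}"
begin

lemma dirac_rhs_components_absolutely_integrable:
  assumes "continuous_on {0..b} Y"
  shows "(\<lambda>t. \<i> * (\<phi> t * snd (Y t) - z * fst (Y t))) absolutely_integrable_on {0..b}"
    and "(\<lambda>t. \<i> * (z * snd (Y t) - cnj (\<phi> t) * fst (Y t))) absolutely_integrable_on {0..b}"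
proof -
  have c: "continuous_on {0..b} (\<lambda>t. fst (Y t))" "continuous_on {0..b} (\<lambda>t. snd (Y t))"
    using assms by (auto intro: continuous_on_fst continuous_on_snd)
  have cnj: "(\<lambda>t. cnj (\<phi> t)) absolutely_integrable_on {0..b}"
    using absolutely_integrable_linear[OF locally_integrable bounded_linear_cnj] by (simp add: o_def)
  have i: "(\<lambda>t. \<i> * f t) absolutely_integrable_on {0..b}" if "f absolutely_integrable_on {0..b}" for f
    using absolutely_integrable_linear[OF that bounded_linear_mult_right[of \<i>]] by (simp add: o_def)
  show "(\<lambda>t. \<i> * (\<phi> t * snd (Y t) - z * fst (Y t))) absolutely_integrable_on {0..b}"
    by (intro i set_integral_diff absolutely_integrable_continuous_mult locally_integrable
        absolutely_integrable_continuous_real continuous_on_mult continuous_on_const c)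
  show "(\<lambda>t. \<i> * (z * snd (Y t) - cnj (\<phi> t) * fst (Y t))) absolutely_integrable_on {0..b}"
    by (intro i set_integral_diff absolutely_integrable_continuous_mult cnj
        absolutely_integrable_continuous_real continuous_on_mult continuous_on_const c)
qed

lemma dirac_rhs_integrable:
  assumes "continuous_on {0..b} Y"
  shows "dirac_rhs \<phi> z Y integrable_on {0..b}"
  using dirac_rhs_components_absolutely_integrable[OF assms, THEN set_lebesgue_integral_eq_integral(1),
      THEN integrable_integral]
  by (auto simp: integrable_on_def has_integral_Pair_iff dirac_rhs_def)

text \<open>The Gronwall weight: its n-th power over n! controls the n-th Picard iterate. It
  vanishes for negative x, where the interval is empty.\<close>

definition mass :: "complex \<Rightarrow> real \<Rightarrow> real" where
  "mass z x = integral {0..x} (\<lambda>t. cmod z + cmod (\<phi> t))"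

lemma coefficient_absolutely_integrable:
  "(\<lambda>t. cmod z + cmod (\<phi> t)) absolutely_integrable_on {0..b}"
  by (intro set_integral_add absolutely_integrable_norm[unfolded o_def] locally_integrable
      absolutely_integrable_continuous_real continuous_intros)

lemma mass_has_integral: "((\<lambda>t. cmod z + cmod (\<phi> t)) has_integral mass z x) {0..x}"
  unfolding mass_def
  using coefficient_absolutely_integrable[where z = z and b = x] by (auto simp: absolutely_integrable_on_def)

lemma mass_mono: "x \<le> y \<Longrightarrow> mass z x \<le> mass z y"
  by (rule has_integral_subset_le[OF _ mass_has_integral mass_has_integral]) auto

lemma mass_nonneg: "0 \<le> mass z x"
  by (rule has_integral_nonneg[OF mass_has_integral]) auto

text \<open>\<open>mass\<close> is a primitive of the coefficient, so integrating one Picard bound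
  against the coefficient produces the next.\<close>

lemma mass_power:
  "((\<lambda>t. (cmod z + cmod (\<phi> t)) * (K * mass z t ^ n / fact n)) has_integral
      K * mass z x ^ Suc n / fact (Suc n)) {0..x}"
proof (cases "x \<ge> 0")
  case True
  have "((\<lambda>t. (cmod z + cmod (\<phi> t)) * mass z t ^ n) has_integral mass z x ^ Suc n / Suc n) {0..x}"
    using True by (intro has_integral_power_rule[OF coefficient_absolutely_integrable[where z = z and b = x]] mass_has_integral) auto
  from has_integral_mult_right[OF this, of "K / fact n"] show ?thesis
    by (rule has_integral_transform) (auto simp: field_simps)
next
  case False
  then show ?thesis by (auto simp: mass_def)
qed

lemma dirac_integral_bound:
  assumes c: "continuous_on {0..x} U"
    and U: "\<And>t. t \<in> {0..x} \<Longrightarrow> norm (U t) \<le> K * mass z t ^ n / fact n"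
  shows "norm (integral {0..x} (dirac_rhs \<phi> z U)) \<le> K * mass z x ^ Suc n / fact (Suc n)"
proof -
  have "norm (integral {0..x} (dirac_rhs \<phi> z U))
      \<le> integral {0..x} (\<lambda>t. (cmod z + cmod (\<phi> t)) * (K * mass z t ^ n / fact n))"
  proof (rule integral_norm_bound_integral[OF dirac_rhs_integrable[OF c] has_integral_integrable[OF mass_power]])
    fix t assume "t \<in> {0..x}"
    then show "norm (dirac_rhs \<phi> z U t) \<le> (cmod z + cmod (\<phi> t)) * (K * mass z t ^ n / fact n)"
      by (intro order_trans[OF norm_dirac_rhs_le] mult_left_mono U) auto
  qed
  then show ?thesis using integral_unique[OF mass_power] by metis
qed

text \<open>The difference of the solutions is a fixed point of the homogeneous Volterra operator.
  Applying the operator n times bounds it by \<open>K * mass z t ^ n / fact n\<close>, which tends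
  to 0. For negative x the integral is over the empty set.\<close>

lemma is_sol_eqI:
  assumes U: "is_sol \<phi> z U" and V: "is_sol \<phi> z V" and "U 0 = V 0"
  shows "U = V"
proof
  fix x
  define D where "D t = U t - V t" for t
  have c: "continuous_on {0..b} D" for b
    unfolding D_def by (intro continuous_intros continuous_on_is_sol[OF U] continuous_on_is_sol[OF V])
  have D: "D t = integral {0..t} (dirac_rhs \<phi> z D)" for t
  proof -
    have "((\<lambda>s. dirac_rhs \<phi> z U s - dirac_rhs \<phi> z V s) has_integral (U t - U 0) - (V t - V 0)) {0..t}"
      using U V by (intro has_integral_diff) (auto simp: is_sol_def)
    then have "(dirac_rhs \<phi> z D has_integral D t) {0..t}"
      by (rule has_integral_transform) (auto simp: D_def dirac_rhs_def algebra_simps \<open>U 0 = V 0\<close>)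
    then show ?thesis by (simp add: integral_unique)
  qed
  have "bounded (D ` {0..x})"
    by (intro compact_imp_bounded compact_continuous_image c) auto
  then obtain K where K: "\<And>t. t \<in> {0..x} \<Longrightarrow> norm (D t) \<le> K"
    unfolding bounded_iff by blast
  have bound: "norm (D t) \<le> K * mass z t ^ n / fact n" if "t \<in> {0..x}" for t n
    using that
  proof (induction n arbitrary: t)
    case 0
    then show ?case using K by simp
  next
    case (Suc n)
    show ?case
      unfolding D[of t] by (rule dirac_integral_bound[OF c Suc.IH]) (use Suc.prems in auto)
  qed
  have "norm (D x) \<le> 0"
  proof (cases "x \<ge> 0")
    case True
    have "(\<lambda>n. K * (mass z x ^ n /\<^sub>R fact n)) \<longlonglongrightarrow> K * 0"
      by (intro tendsto_mult tendsto_const summable_LIMSEQ_zero summable_exp_generic)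
    then have "(\<lambda>n. K * mass z x ^ n / fact n) \<longlonglongrightarrow> 0" by (simp add: field_simps)
    then show ?thesis
      by (rule tendsto_lowerbound) (use bound True in auto)
  next
    case False
    then show ?thesis using D[of x] by simp
  qed
  then show "U x = V x" by (simp add: D_def)
qed

text \<open>Neumann series: \<open>P n\<close> is the n-th power of the Volterra operator applied to
  the constant v. The factorial bounds give convergence and a majorant, and dominated convergence
  carries the integral equation to the limit.\<close>

lemma ex_is_sol: "\<exists>Y. is_sol \<phi> z Y \<and> Y 0 = v"
proof -
  define P where "P = rec_nat (\<lambda>_. v) (\<lambda>_ U x. integral {0..x} (dirac_rhs \<phi> z U))"
  have P0: "P 0 = (\<lambda>_. v)" and PS: "P (Suc n) x = integral {0..x} (dirac_rhs \<phi> z (P n))" for n x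
    by (auto simp: P_def)
  have c: "continuous_on {0..b} (P n)" for n b
  proof (induction n)
    case 0
    then show ?case by (simp add: P0)
  next
    case (Suc n)
    have "P (Suc n) = (\<lambda>x. integral {0..x} (dirac_rhs \<phi> z (P n)))" by (auto simp: PS)
    then show ?case
      using indefinite_integral_continuous_1[OF dirac_rhs_integrable[OF Suc]] by simp
  qed
  have bound: "norm (P n x) \<le> norm v * mass z x ^ n / fact n" for n x
  proof (induction n arbitrary: x)
    case 0
    then show ?case by (simp add: P0)
  next
    case (Suc n)
    show ?case
      unfolding PS by (rule dirac_integral_bound[OF c Suc])
  qed
  have sums: "(\<lambda>n. norm v * mass z x ^ n / fact n) sums (norm v * exp (mass z x))" for x
    using sums_mult[OF exp_converges[of "mass z x"], of "norm v"] by (simp add: field_simps)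
  have summable: "summable (\<lambda>n. P n x)" for x
    by (rule summable_comparison_test'[OF sums_summable[OF sums[of x]], of 0]) (use bound in auto)
  define Y where "Y x = (\<Sum>n. P n x)" for x
  define S where "S N x = (\<Sum>n<N. P n x)" for N x
  have SY: "(\<lambda>N. S N x) \<longlonglongrightarrow> Y x" for x
    using summable_LIMSEQ[OF summable] by (simp add: S_def Y_def)
  have S_bound: "norm (S N x) \<le> norm v * exp (mass z x)" for N x
  proof -
    have "norm (S N x) \<le> (\<Sum>n<N. norm v * mass z x ^ n / fact n)"
      unfolding S_def by (rule sum_norm_le) (use bound in auto)
    also have "\<dots> \<le> norm v * exp (mass z x)"
      unfolding sums_unique[OF sums[of x]]
      by (intro sum_le_suminf sums_summable[OF sums]) (auto simp: mass_nonneg)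
    finally show ?thesis .
  qed
  have cS: "continuous_on {0..b} (S N)" for N b
    unfolding S_def by (intro continuous_intros c)
  have RS: "dirac_rhs \<phi> z (S N) = (\<lambda>t. \<Sum>n<N. dirac_rhs \<phi> z (P n) t)" for N
  proof
    fix t
    have "dirac_rhs \<phi> z (S N) t = dirac_rhs \<phi> z (\<lambda>_. \<Sum>n<N. P n t) t"
      by (simp add: dirac_rhs_def S_def)
    also have "\<dots> = (\<Sum>n<N. dirac_rhs \<phi> z (\<lambda>_. P n t) t)"
      by (rule linear_sum[OF bounded_linear.linear[OF bounded_linear_dirac_rhs]])
    finally show "dirac_rhs \<phi> z (S N) t = (\<Sum>n<N. dirac_rhs \<phi> z (P n) t)"
      by (simp flip: dirac_rhs_const)
  qed
  \<comment> \<open>The zeroth term supplies the initial value; shifting the index turns the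
    remaining terms into integrals of the previous ones.\<close>
  have S_Suc: "S (Suc N) x = v + integral {0..x} (dirac_rhs \<phi> z (S N))" for N x
    unfolding RS S_def sum.lessThan_Suc_shift
    by (subst integral_sum) (auto simp: P0 PS intro!: dirac_rhs_integrable c)
  have main: "(dirac_rhs \<phi> z Y has_integral Y x - v) {0..x}" for x
  proof -
    \<comment> \<open>An integrable majorant independent of N: the exponential is taken at the right
      end x, where \<open>mass\<close> is largest.\<close>
    let ?h = "\<lambda>t. (cmod z + cmod (\<phi> t)) * (norm v * exp (mass z x))"
    have le: "norm (dirac_rhs \<phi> z (S N) t) \<le> ?h t" if "t \<in> {0..x}" for N t
    proof (rule order_trans[OF norm_dirac_rhs_le mult_left_mono])
      show "norm (S N t) \<le> norm v * exp (mass z x)"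
        using S_bound[of N t] mass_mono[of t x z] that
        by (smt (verit) atLeastAtMost_iff exp_le_cancel_iff mult_left_mono norm_ge_zero)
    qed auto
    have h: "?h integrable_on {0..x}"
      using has_integral_mult_left[OF mass_has_integral[of z x]] by (blast intro: has_integral_integrable)
    have conv: "(\<lambda>N. dirac_rhs \<phi> z (S N) t) \<longlonglongrightarrow> dirac_rhs \<phi> z Y t" for t
      using bounded_linear.tendsto[OF bounded_linear_dirac_rhs SY[of t], of \<phi> z t]
      by (simp flip: dirac_rhs_const)
    have int: "dirac_rhs \<phi> z Y integrable_on {0..x}"
      and lim: "(\<lambda>N. integral {0..x} (dirac_rhs \<phi> z (S N))) \<longlonglongrightarrow> integral {0..x} (dirac_rhs \<phi> z Y)"
      using dominated_convergence[OF dirac_rhs_integrable[OF cS] h le conv] by auto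
    have "(\<lambda>N. S (Suc N) x) \<longlonglongrightarrow> v + integral {0..x} (dirac_rhs \<phi> z Y)"
      unfolding S_Suc by (intro tendsto_intros lim)
    then have "Y x = v + integral {0..x} (dirac_rhs \<phi> z Y)"
      using LIMSEQ_unique[OF LIMSEQ_Suc[OF SY]] by blast
    then show ?thesis using int by (simp add: has_integral_iff)
  qed
  have "Y 0 = v" using main[of 0] by (auto dest: has_integral_unique[OF _ has_integral_refl(2)])
  then show ?thesis using main by (auto simp: is_sol_def)
qed

lemma sol_is_sol: "is_sol \<phi> z (sol \<phi> z v)" and sol_0: "sol \<phi> z v 0 = v"
proof -
  have "\<exists>!Y. is_sol \<phi> z Y \<and> Y 0 = v"
    using ex_is_sol[of z v] is_sol_eqI[of z] by metis
  from theI'[OF this] show "is_sol \<phi> z (sol \<phi> z v)" "sol \<phi> z v 0 = v"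
    by (auto simp: sol_def)
qed

lemma sol_unique: "is_sol \<phi> z Y \<Longrightarrow> Y = sol \<phi> z (Y 0)"
  by (rule is_sol_eqI) (auto simp: sol_is_sol sol_0)

lemma sol_linear:
  "sol \<phi> z (a * v1 + b * w1, a * v2 + b * w2) x =
    (a * fst (sol \<phi> z (v1, v2) x) + b * fst (sol \<phi> z (w1, w2) x),
     a * snd (sol \<phi> z (v1, v2) x) + b * snd (sol \<phi> z (w1, w2) x))"
proof -
  have "is_sol \<phi> z (\<lambda>x. (a * fst (sol \<phi> z (v1, v2) x), a * snd (sol \<phi> z (v1, v2) x))
      + (b * fst (sol \<phi> z (w1, w2) x), b * snd (sol \<phi> z (w1, w2) x)))"
    by (intro is_sol_add is_sol_scale sol_is_sol)
  from sol_unique[OF this] show ?thesis by (simp add: sol_0 fun_eq_iff)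
qed

text \<open>Instances of this identity: constancy of the determinant
  (\<open>z = w\<close>), the energy identity (\<open>V\<close> the conjugate swap of \<open>U\<close>) and variation of constants.\<close>
lemma wronskian_has_integral:
  assumes U: "is_sol \<phi> z U" and V: "is_sol \<phi> w V" and "0 \<le> x"
  shows "((\<lambda>t. \<i> * (w - z) * (fst (U t) * snd (V t) + snd (U t) * fst (V t))) has_integral
     (fst (U x) * snd (V x) - snd (U x) * fst (V x)) - (fst (U 0) * snd (V 0) - snd (U 0) * fst (V 0))) {0..x}"
proof -
  note aU = dirac_rhs_components_absolutely_integrable[OF continuous_on_is_sol[OF U], where z = z]
  note aV = dirac_rhs_components_absolutely_integrable[OF continuous_on_is_sol[OF V], where z = w]
  have "((\<lambda>t. \<i> * (\<phi> t * snd (U t) - z * fst (U t)) * snd (V t)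
        + fst (U t) * (\<i> * (w * snd (V t) - cnj (\<phi> t) * fst (V t)))) has_integral
      fst (U x) * snd (V x) - fst (U 0) * snd (V 0)) {0..x}"
    using U V \<open>0 \<le> x\<close> by (intro has_integral_product_rule aU aV) (auto simp: is_sol_iff)
  moreover have "((\<lambda>t. \<i> * (z * snd (U t) - cnj (\<phi> t) * fst (U t)) * fst (V t)
        + snd (U t) * (\<i> * (\<phi> t * snd (V t) - w * fst (V t)))) has_integral
      snd (U x) * fst (V x) - snd (U 0) * fst (V 0)) {0..x}"
    using U V \<open>0 \<le> x\<close> by (intro has_integral_product_rule aU aV) (auto simp: is_sol_iff)
  ultimately show ?thesis
    by (rule has_integral_transform[OF has_integral_diff]) (auto simp: algebra_simps)
qed

end

section \<open>The Weyl solution\<close>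

text \<open>Monotone convergence for the truncations of f to [0, k].\<close>

lemma integrable_on_atLeast_bounded:
  fixes f :: "real \<Rightarrow> real"
  assumes int: "\<And>L. f integrable_on {0..L}" and nn: "\<And>x. x \<ge> 0 \<Longrightarrow> f x \<ge> 0"
    and bound: "\<And>L. L \<ge> 0 \<Longrightarrow> integral {0..L} f \<le> B"
  shows "f integrable_on {0..}"
proof -
  let ?f = "\<lambda>(k::nat) x. if x \<in> {0..real k} then f x else 0"
  have hi: "(?f k has_integral integral {0..real k} f) {0..}" for k
    by (subst has_integral_restrict) (auto intro: integrable_integral int)
  have "f integrable_on {0..} \<and> (\<lambda>k. integral {0..} (?f k)) \<longlonglongrightarrow> integral {0..} f"
  proof (rule monotone_convergence_increasing)
    show "?f k integrable_on {0..}" for k using hi by blast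
    show "?f k x \<le> ?f (Suc k) x" if "x \<in> {0..}" for k x using nn that by auto
    show "(\<lambda>k. ?f k x) \<longlonglongrightarrow> f x" if "x \<in> {0..}" for x
    proof (rule tendsto_eventually)
      obtain N :: nat where "x \<le> real N" using real_arch_simple by blast
      then show "\<forall>\<^sub>F k in sequentially. ?f k x = f x"
        using that by (intro eventually_mono[OF eventually_ge_at_top[of N]]) auto
    qed
    have "\<bar>integral {0..real k} f\<bar> \<le> B" for k
      using bound[of "real k"] integral_nonneg[OF int, of "real k"] nn by auto
    then show "bounded (range (\<lambda>k. integral {0..} (?f k)))"
      using integral_unique[OF hi] by (auto simp: bounded_iff)
  qed
  then show ?thesis by blast
qed

text \<open>The indefinite form preserved by SU(1,1). On vectors (s, 1) it is nonpositive exactly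
  when s lies in the closed unit disc.\<close>

definition signature_form :: "complex \<times> complex \<Rightarrow> real" where
  "signature_form v = (cmod (fst v))\<^sup>2 - (cmod (snd v))\<^sup>2"

lemma norm_pair_sq: "(norm v)\<^sup>2 = (cmod (fst v))\<^sup>2 + (cmod (snd v))\<^sup>2"
  for v :: "complex \<times> complex"
  by (simp add: norm_prod_def)

lemma norm_add_sq_le: "(norm (u + v))\<^sup>2 \<le> 2 * (norm u)\<^sup>2 + 2 * (norm v)\<^sup>2"
  for u v :: "'a::real_normed_vector"
proof -
  have "(norm (u + v))\<^sup>2 \<le> (norm u + norm v)\<^sup>2"
    by (intro power_mono norm_triangle_ineq) auto
  also have "\<dots> \<le> 2 * (norm u)\<^sup>2 + 2 * (norm v)\<^sup>2"
    using sum_squares_ge_zero[of "norm u - norm v" 0] by (simp add: power2_eq_square algebra_simps)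
  finally show ?thesis .
qed

context dirac_system
begin

lemma is_sol_integrable_sq:
  assumes "is_sol \<phi> z Y"
  shows "(\<lambda>t. (norm (Y t))\<^sup>2) integrable_on {0..L}"
  by (intro integrable_continuous_real continuous_intros continuous_on_is_sol[OF assms])

text \<open>The Wronskian of \<open>Y\<close> with its conjugate swap is
  \<open>signature_form (Y x)\<close>, and the spectral difference \<open>cnj z - z\<close>
  contributes the factor 2 Im z.\<close>

lemma energy_has_integral:
  assumes Y: "is_sol \<phi> z Y" and "0 \<le> x"
  shows "((\<lambda>t. 2 * Im z * (norm (Y t))\<^sup>2) has_integral signature_form (Y x) - signature_form (Y 0)) {0..x}"
proof -
  have *: "\<i> * (cnj z - z) = of_real (2 * Im z)"
    by (simp add: complex_eq_iff)
  from has_integral_linear[OF wronskian_has_integral[OF Y is_sol_cnj_swap[OF Y] \<open>0 \<le> x\<close>] bounded_linear_Re]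
  show ?thesis
    unfolding *
    by (rule has_integral_transform, unfold norm_pair_sq signature_form_def cmod_power2)
      (auto simp: algebra_simps power2_eq_square)
qed

lemma signature_form_mono:
  assumes "is_sol \<phi> z Y" "Im z \<ge> 0" "0 \<le> x" "x \<le> y"
  shows "signature_form (Y x) \<le> signature_form (Y y)"
proof -
  have "signature_form (Y x) - signature_form (Y 0) \<le> signature_form (Y y) - signature_form (Y 0)"
    by (rule has_integral_subset_le[OF _ energy_has_integral energy_has_integral]) (use assms in auto)
  then show ?thesis by simp
qed

text \<open>The Weyl solution comes from an intersection of nested compact discs: \<open>signature_form\<close> increases along
  solutions in the upper half plane, so \<open>signature_form (\<Psi> L) \<le> 0\<close> becomes more restrictive as \<open>L\<close> grows.\<close>
lemma ex_weyl:
  assumes "Im z > 0"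
  shows "\<exists>s. \<forall>x\<ge>0. signature_form (sol \<phi> z (s, 1) x) \<le> 0"
proof -
  \<comment> \<open>The Weyl disc at n, written out through the two basis solutions so that
    continuity in s, hence closedness, is visible.\<close>
  define D where "D n = {s. signature_form (s * fst (sol \<phi> z (1, 0) (real n)) + fst (sol \<phi> z (0, 1) (real n)),
      s * snd (sol \<phi> z (1, 0) (real n)) + snd (sol \<phi> z (0, 1) (real n))) \<le> 0}" for n :: nat
  have lin: "sol \<phi> z (s, 1) x = (s * fst (sol \<phi> z (1, 0) x) + fst (sol \<phi> z (0, 1) x),
      s * snd (sol \<phi> z (1, 0) x) + snd (sol \<phi> z (0, 1) x))" for s x
    using sol_linear[of z s 1 1 0 0 1] by simp
  have D_iff: "s \<in> D n \<longleftrightarrow> signature_form (sol \<phi> z (s, 1) (real n)) \<le> 0" for s n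
    unfolding lin[of s "real n"] D_def by simp
  have mono: "signature_form (sol \<phi> z (s, 1) x) \<le> signature_form (sol \<phi> z (s, 1) y)" if "0 \<le> x" "x \<le> y" for s x y
    using signature_form_mono[OF sol_is_sol] assms that by force
  have nest: "D n \<subseteq> D m" if "m \<le> n" for m n
  proof
    fix s assume "s \<in> D n"
    then show "s \<in> D m" using mono[of "real m" "real n" s] that by (simp add: D_iff)
  qed
  have "closed (D n)" for n
    unfolding D_def signature_form_def fst_conv snd_conv by (intro closed_Collect_le continuous_intros)
  \<comment> \<open>\<open>D 0\<close> is the closed unit disc, because the solution starts at (s,
    1).\<close>
  moreover have "D n \<subseteq> cball 0 1" for n
    using nest[of 0 n] by (auto simp: D_iff sol_0 signature_form_def power_le_one_iff)
  ultimately have "compact (D n)" for n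
    by (auto simp: compact_eq_bounded_closed intro: bounded_subset[OF bounded_cball])
  \<comment> \<open>The witness makes the first component vanish at n. Division is safe: the form of
    the first column starts at 1 and increases, so its first entry has modulus at least 1.\<close>
  moreover have "D n \<noteq> {}" for n
  proof -
    let ?t = "fst (sol \<phi> z (1, 0) (real n))"
    have "signature_form (sol \<phi> z (1, 0) 0) \<le> signature_form (sol \<phi> z (1, 0) (real n))"
      using signature_form_mono[OF sol_is_sol] assms by force
    then have "1 \<le> signature_form (sol \<phi> z (1, 0) (real n))" by (simp add: signature_form_def sol_0)
    then have "?t \<noteq> 0"
      using zero_le_power2[of "cmod (snd (sol \<phi> z (1, 0) (real n)))"] unfolding signature_form_def by force
    then have "- fst (sol \<phi> z (0, 1) (real n)) / ?t \<in> D n"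
      by (simp add: D_def signature_form_def)
    then show ?thesis by blast
  qed
  ultimately have "\<Inter>(range D) \<noteq> {}"
    using nest by (intro compact_nest) auto
  then obtain s where s: "\<And>n. s \<in> D n" by blast
  have "signature_form (sol \<phi> z (s, 1) x) \<le> 0" if "x \<ge> 0" for x
  proof -
    obtain n :: nat where "x \<le> real n" using real_arch_simple by blast
    then show ?thesis using mono[of x "real n" s] s[of n] that by (auto simp: D_iff)
  qed
  then show ?thesis by blast
qed

text \<open>The difference of the solutions starts at (s - r, 0), where the form has the value k.
  The form only grows and is dominated by the squared norm, so square integrability on the half line
  forces k = 0.\<close>

lemma weyl_unique:
  assumes U: "is_sol \<phi> z U" "(\<lambda>x. (norm (U x))\<^sup>2) integrable_on {0..}" "U 0 = (s, 1)"
    and V: "is_sol \<phi> z V" "(\<lambda>x. (norm (V x))\<^sup>2) integrable_on {0..}" "V 0 = (r, 1)"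
    and "Im z > 0"
  shows "s = r"
proof -
  define D where "D x = U x + (- 1 * fst (V x), - 1 * snd (V x))" for x
  have D: "is_sol \<phi> z D"
    unfolding D_def by (intro is_sol_add U is_sol_scale V)
  define k where "k = (cmod (s - r))\<^sup>2"
  define I where "I = integral {0..} (\<lambda>x. (norm (U x))\<^sup>2)"
  define J where "J = integral {0..} (\<lambda>x. (norm (V x))\<^sup>2)"
  have bound: "L * k \<le> 2 * I + 2 * J" if "L \<ge> 0" for L
  proof -
    have "integral {0..L} (\<lambda>x. k) \<le> integral {0..L} (\<lambda>x. 2 * (norm (U x))\<^sup>2 + 2 * (norm (V x))\<^sup>2)"
    proof (rule integral_le)
      fix x assume x: "x \<in> {0..L}"
      have "k = signature_form (D 0)" by (simp add: D_def k_def signature_form_def U V)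
      also have "\<dots> \<le> signature_form (D x)" using signature_form_mono[OF D, of 0 x] x \<open>Im z > 0\<close> by simp
      also have "\<dots> \<le> (norm (D x))\<^sup>2" by (simp add: signature_form_def norm_pair_sq)
      also have "D x = U x + - V x" by (simp add: D_def prod_eq_iff)
      also have "(norm (U x + - V x))\<^sup>2 \<le> 2 * (norm (U x))\<^sup>2 + 2 * (norm (V x))\<^sup>2"
        using norm_add_sq_le[of "U x" "- V x"] by simp
      finally show "k \<le> 2 * (norm (U x))\<^sup>2 + 2 * (norm (V x))\<^sup>2" .
    qed (auto intro!: integrable_add integrable_on_cmult_left is_sol_integrable_sq[OF U(1)] is_sol_integrable_sq[OF V(1)])
    also have "\<dots> = 2 * integral {0..L} (\<lambda>x. (norm (U x))\<^sup>2) + 2 * integral {0..L} (\<lambda>x. (norm (V x))\<^sup>2)"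
      by (subst integral_add) (auto intro!: integrable_on_cmult_left is_sol_integrable_sq[OF U(1)] is_sol_integrable_sq[OF V(1)])
    also have "\<dots> \<le> 2 * I + 2 * J" unfolding I_def J_def
      by (intro add_mono mult_left_mono integral_subset_le U V is_sol_integrable_sq[OF U(1)] is_sol_integrable_sq[OF V(1)]) auto
    finally show ?thesis using that by simp
  qed
  have "k \<le> 0"
  proof (rule ccontr)
    assume "\<not> k \<le> 0"
    moreover have "0 \<le> 2 * I + 2 * J" using bound[of 0] by simp
    ultimately show False using bound[of "(2 * I + 2 * J + 1) / k"] by (auto simp: field_simps)
  qed
  then show ?thesis by (simp add: k_def)
qed

text \<open>Discharges the definite description in \<open>schur\<close>: nested discs give
  existence, \<open>weyl_unique\<close> gives uniqueness. The energy bound combines the form's value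
  at 0 with its nonpositivity at L.\<close>

lemma schur_weyl_solution:
  assumes "Im z > 0"
  obtains \<Psi> where "is_sol \<phi> z \<Psi>" "\<Psi> 0 = (schur \<phi> z, 1)" "cmod (schur \<phi> z) < 1"
    "\<forall>L\<ge>0. 2 * Im z * integral {0..L} (\<lambda>x. (norm (\<Psi> x))\<^sup>2) \<le> 1 - (cmod (schur \<phi> z))\<^sup>2"
proof -
  obtain s where s: "\<And>x. x \<ge> 0 \<Longrightarrow> signature_form (sol \<phi> z (s, 1) x) \<le> 0"
    using ex_weyl[OF assms] by blast
  let ?\<Psi> = "sol \<phi> z (s, 1)"
  have bound: "2 * Im z * integral {0..L} (\<lambda>x. (norm (?\<Psi> x))\<^sup>2) \<le> 1 - (cmod s)\<^sup>2" if "L \<ge> 0" for L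
  proof -
    have "2 * Im z * integral {0..L} (\<lambda>x. (norm (?\<Psi> x))\<^sup>2) = signature_form (?\<Psi> L) - signature_form (?\<Psi> 0)"
      using integral_unique[OF energy_has_integral[OF sol_is_sol that, of z "(s, 1)"]] by simp
    then show ?thesis using s[OF that] by (simp add: sol_0 signature_form_def)
  qed
  have int: "(\<lambda>x. (norm (?\<Psi> x))\<^sup>2) integrable_on {0..}"
  proof (rule integrable_on_atLeast_bounded)
    show "integral {0..L} (\<lambda>x. (norm (?\<Psi> x))\<^sup>2) \<le> (1 - (cmod s)\<^sup>2) / (2 * Im z)" if "L \<ge> 0" for L
      using bound[OF that] assms by (simp add: field_simps)
  qed (auto intro: is_sol_integrable_sq[OF sol_is_sol])
  have "schur \<phi> z = s"
    unfolding schur_def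
  proof (rule the_equality)
    show "\<exists>\<Psi>. is_sol \<phi> z \<Psi> \<and> \<Psi> 0 = (s, 1) \<and> (\<lambda>x. (norm (\<Psi> x))\<^sup>2) integrable_on {0..}"
      using int sol_is_sol sol_0 by blast
    show "r = s" if "\<exists>\<Psi>. is_sol \<phi> z \<Psi> \<and> \<Psi> 0 = (r, 1) \<and> (\<lambda>x. (norm (\<Psi> x))\<^sup>2) integrable_on {0..}" for r
      using that weyl_unique[OF _ _ _ sol_is_sol int sol_0 assms] by blast
  qed
  \<comment> \<open>If s had modulus at least 1, the energy bound would make the solution vanish on
    [0, 1], against its initial value (s, 1).\<close>
  moreover have "cmod s < 1"
  proof (rule ccontr)
    assume "\<not> cmod s < 1"
    then have "1 - (cmod s)\<^sup>2 \<le> 0" by (simp add: one_le_power)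
    then have "Im z * integral {0..1} (\<lambda>x. (norm (?\<Psi> x))\<^sup>2) \<le> 0" using bound[of 1] by simp
    then have "integral {0..1} (\<lambda>x. (norm (?\<Psi> x))\<^sup>2) \<le> 0"
      using assms by (simp add: mult_le_0_iff)
    moreover have "0 \<le> integral {0..1} (\<lambda>x. (norm (?\<Psi> x))\<^sup>2)"
      by (intro integral_nonneg is_sol_integrable_sq[OF sol_is_sol]) auto
    ultimately have "integral {0..1} (\<lambda>x. (norm (?\<Psi> x))\<^sup>2) = 0" by simp
    then have "\<forall>x\<in>{0..1}. (norm (?\<Psi> x))\<^sup>2 = 0"
      by (subst (asm) integral_eq_0_iff) (auto intro!: continuous_intros continuous_on_is_sol[OF sol_is_sol])
    then have "?\<Psi> 0 = 0" by auto
    then show False by (simp add: sol_0 zero_prod_def)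
  qed
  ultimately show thesis
    using that[of ?\<Psi>] bound sol_is_sol sol_0 by auto
qed

end

section \<open>The perturbation estimate\<close>

text \<open>The integral of (f - r g) squared is a nonnegative quadratic polynomial in r. Its
  minimum at r = B / C gives the inequality; for C = 0 it is affine, hence constant.\<close>

lemma Cauchy_Schwarz_integral:
  fixes f g :: "real \<Rightarrow> real"
  assumes f: "continuous_on {a..b} f" and g: "continuous_on {a..b} g"
  shows "(integral {a..b} (\<lambda>t. f t * g t))\<^sup>2
    \<le> integral {a..b} (\<lambda>t. (f t)\<^sup>2) * integral {a..b} (\<lambda>t. (g t)\<^sup>2)"
proof -
  define A B C where "A = integral {a..b} (\<lambda>t. (f t)\<^sup>2)" and "B = integral {a..b} (\<lambda>t. f t * g t)"
    and "C = integral {a..b} (\<lambda>t. (g t)\<^sup>2)"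
  have A: "((\<lambda>t. (f t)\<^sup>2) has_integral A) {a..b}" and B: "((\<lambda>t. f t * g t) has_integral B) {a..b}"
    and C: "((\<lambda>t. (g t)\<^sup>2) has_integral C) {a..b}"
    unfolding A_def B_def C_def
    by (intro integrable_integral integrable_continuous_real continuous_intros f g)+
  have quad: "0 \<le> A - 2 * r * B + r\<^sup>2 * C" for r
  proof -
    have "((\<lambda>t. (f t)\<^sup>2 - 2 * r * (f t * g t) + r\<^sup>2 * (g t)\<^sup>2) has_integral A - 2 * r * B + r\<^sup>2 * C) {a..b}"
      by (intro has_integral_add has_integral_diff has_integral_mult_right A B C)
    then have "((\<lambda>t. (f t - r * g t)\<^sup>2) has_integral A - 2 * r * B + r\<^sup>2 * C) {a..b}"
      by (rule has_integral_transform) (auto simp: power2_eq_square algebra_simps)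
    then show ?thesis by (rule has_integral_nonneg) auto
  qed
  have "C \<ge> 0" by (rule has_integral_nonneg[OF C]) auto
  have "B\<^sup>2 \<le> A * C"
  proof (cases "C = 0")
    case True
    have "B = 0"
    proof (rule ccontr)
      assume "B \<noteq> 0"
      then show False using quad[of "(A + 1) / (2 * B)"] True by simp
    qed
    then show ?thesis using True by simp
  next
    case False
    then have "C > 0" using \<open>C \<ge> 0\<close> by simp
    then have "0 \<le> (A - 2 * (B / C) * B + (B / C)\<^sup>2 * C) * C" using quad[of "B / C"] by simp
    also have "\<dots> = A * C - B\<^sup>2" using \<open>C > 0\<close> by (simp add: field_simps power2_eq_square)
    finally show ?thesis by simp
  qed
  then show ?thesis by (simp add: A_def B_def C_def)
qed

lemma Cauchy_Schwarz_integral_pair: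
  fixes f g u v :: "real \<Rightarrow> complex"
  assumes c: "continuous_on {a..b} f" "continuous_on {a..b} g" "continuous_on {a..b} u" "continuous_on {a..b} v"
  shows "(cmod (integral {a..b} (\<lambda>t. f t * u t + g t * v t)))\<^sup>2
    \<le> integral {a..b} (\<lambda>t. (cmod (f t))\<^sup>2 + (cmod (g t))\<^sup>2) * integral {a..b} (\<lambda>t. (cmod (u t))\<^sup>2 + (cmod (v t))\<^sup>2)"
proof -
  let ?F = "\<lambda>t. norm (f t, g t)" and ?G = "\<lambda>t. norm (u t, v t)"
  have cFG: "continuous_on {a..b} ?F" "continuous_on {a..b} ?G"
    by (intro continuous_intros c)+
  have "cmod (integral {a..b} (\<lambda>t. f t * u t + g t * v t)) \<le> integral {a..b} (\<lambda>t. ?F t * ?G t)"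
  proof (rule integral_norm_bound_integral)
    fix t
    have "cmod (f t * u t + g t * v t) \<le> inner (cmod (f t), cmod (g t)) (cmod (u t), cmod (v t))"
      using norm_triangle_ineq[of "f t * u t" "g t * v t"] by (simp add: norm_mult inner_prod_def)
    also have "\<dots> \<le> norm (cmod (f t), cmod (g t)) * norm (cmod (u t), cmod (v t))"
      by (rule norm_cauchy_schwarz)
    also have "\<dots> = ?F t * ?G t" by (simp add: norm_prod_def)
    finally show "cmod (f t * u t + g t * v t) \<le> ?F t * ?G t" .
  qed (intro integrable_continuous_real continuous_intros c cFG)+
  then have "(cmod (integral {a..b} (\<lambda>t. f t * u t + g t * v t)))\<^sup>2 \<le> (integral {a..b} (\<lambda>t. ?F t * ?G t))\<^sup>2"
    by (intro power_mono) auto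
  also have "\<dots> \<le> integral {a..b} (\<lambda>t. (?F t)\<^sup>2) * integral {a..b} (\<lambda>t. (?G t)\<^sup>2)"
    by (rule Cauchy_Schwarz_integral[OF cFG])
  finally show ?thesis by (simp add: norm_pair_sq)
qed

text \<open>\<open>p\<close> and \<open>m\<close> are treated here as arbitrary continuous
  functions. The differential equation enters through the variation formulas assumed in
  \<open>quadratic_bound\<close>.\<close>

locale solution_pair =
  fixes p m :: "real \<Rightarrow> complex" and L :: real
  assumes p: "continuous_on {0..L} p" and m: "continuous_on {0..L} m" and L: "0 \<le> L"
begin

definition "Np x = integral {0..x} (\<lambda>t. (cmod (p t))\<^sup>2)"
definition "Nm x = integral {0..x} (\<lambda>t. (cmod (m t))\<^sup>2)"
text \<open>For the actual solutions the real part of \<open>p t * cnj (m t)\<close> is constantly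
  1, so \<open>j\<close> is its varying part.\<close>

definition "j t = Im (p t * cnj (m t))"
definition "J x = integral {0..x} j"

lemma continuous_on_sub:
  assumes "x \<in> {0..L}"
  shows "continuous_on {0..x} p" "continuous_on {0..x} m"
  using assms by (auto intro: continuous_on_subset[OF p] continuous_on_subset[OF m])

lemma has_integral_NNJ:
  assumes "x \<in> {0..L}"
  shows "((\<lambda>t. (cmod (p t))\<^sup>2) has_integral Np x) {0..x}"
    and "((\<lambda>t. (cmod (m t))\<^sup>2) has_integral Nm x) {0..x}"
    and "(j has_integral J x) {0..x}"
  unfolding Np_def Nm_def J_def j_def
  by (intro integrable_integral integrable_continuous_real continuous_intros continuous_on_sub[OF assms])+

text \<open>The squared Hilbert--Schmidt norm of the kernel \<open>G(x, t)\<close> of variation of constants, integrated over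
  \<open>t\<close> in \<open>[0, x]\<close>. It is an exact derivative in \<open>x\<close>, so no double integral is needed.\<close>
definition "kern x = (cmod (p x))\<^sup>2 * Nm x + (cmod (m x))\<^sup>2 * Np x - 2 * j x * J x"

lemma kern_has_integral: "(kern has_integral Np L * Nm L - (J L)\<^sup>2) {0..L}"
proof -
  have ai: "(\<lambda>t. (cmod (p t))\<^sup>2) absolutely_integrable_on {0..L}"
    "(\<lambda>t. (cmod (m t))\<^sup>2) absolutely_integrable_on {0..L}" "j absolutely_integrable_on {0..L}"
    unfolding j_def by (intro absolutely_integrable_continuous_real continuous_intros p m)+
  have 0: "Np 0 = 0" "Nm 0 = 0" "J 0 = 0" by (auto simp: Np_def Nm_def J_def)
  have "((\<lambda>t. (cmod (p t))\<^sup>2 * Nm t + Np t * (cmod (m t))\<^sup>2) has_integral Np L * Nm L - Np 0 * Nm 0) {0..L}"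
    by (rule has_integral_product_rule[OF L ai(1,2)]) (use has_integral_NNJ 0 in auto)
  moreover have "((\<lambda>t. j t * J t + J t * j t) has_integral J L * J L - J 0 * J 0) {0..L}"
    by (rule has_integral_product_rule[OF L ai(3,3)]) (use has_integral_NNJ 0 in auto)
  ultimately show ?thesis
    by (rule has_integral_transform[OF has_integral_diff])
      (auto simp: 0 kern_def algebra_simps power2_eq_square)
qed

text \<open>The two squares are the entries of the first row of the kernel matrix. The second row
  consists of their negated conjugates in reverse order, so each row carries half of
  \<open>kern x\<close>.\<close>

lemma kernel_entries:
  assumes "x \<in> {0..L}"
  shows "((\<lambda>t. (cmod ((p x * cnj (m t) + m x * cnj (p t)) / 2))\<^sup>2
        + (cmod ((m x * p t - p x * m t) / 2))\<^sup>2) has_integral kern x / 2) {0..x}"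
proof -
  note NN = has_integral_NNJ[OF assms]
  have "((\<lambda>t. ((cmod (p x))\<^sup>2 * (cmod (m t))\<^sup>2 + (cmod (m x))\<^sup>2 * (cmod (p t))\<^sup>2) / 2 - j x * j t) has_integral
      ((cmod (p x))\<^sup>2 * Nm x + (cmod (m x))\<^sup>2 * Np x) / 2 - j x * J x) {0..x}"
    by (intro has_integral_diff has_integral_divide has_integral_add has_integral_mult_right NN)
  then show ?thesis
  proof (rule has_integral_transform)
    fix t
    \<comment> \<open>With P = \<open>p x * cnj (m x)\<close> and Q =
      \<open>p t * cnj (m t)\<close>, the cross terms combine to (Re (P Q) - Re (cnj P Q)) / 2 = -
      Im P Im Q.\<close>
    have "(cmod ((p x * cnj (m t) + m x * cnj (p t)) / 2))\<^sup>2 + (cmod ((m x * p t - p x * m t) / 2))\<^sup>2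
      = ((cmod (p x * cnj (m t) + m x * cnj (p t)))\<^sup>2 + (cmod (m x * p t - p x * m t))\<^sup>2) / 4"
      by (simp add: norm_divide power_divide field_simps)
    then show "((cmod (p x))\<^sup>2 * (cmod (m t))\<^sup>2 + (cmod (m x))\<^sup>2 * (cmod (p t))\<^sup>2) / 2 - j x * j t
      = (cmod ((p x * cnj (m t) + m x * cnj (p t)) / 2))\<^sup>2 + (cmod ((m x * p t - p x * m t) / 2))\<^sup>2"
      by (simp add: cmod_power2 j_def) algebra
  qed (simp add: kern_def)
qed

lemma kern_nonneg: "x \<in> {0..L} \<Longrightarrow> 0 \<le> kern x"
  using has_integral_nonneg[OF kernel_entries, of x] by simp

lemma J_sq_le: "(J L)\<^sup>2 \<le> Np L * Nm L"
  using has_integral_nonneg[OF kern_has_integral kern_nonneg] by simp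

text \<open>The minus sign in the second component cancels the products of real parts in the cross
  terms; only products of imaginary parts remain, which integrate to \<open>J L\<close>.\<close>

lemma combination_has_integral:
  "((\<lambda>t. (cmod (\<alpha> * p t + \<beta> * m t))\<^sup>2 + (cmod (\<alpha> * cnj (p t) - \<beta> * cnj (m t)))\<^sup>2) has_integral
     2 * (cmod \<alpha>)\<^sup>2 * Np L + 2 * (cmod \<beta>)\<^sup>2 * Nm L - 4 * Im (\<alpha> * cnj \<beta>) * J L) {0..L}"
proof -
  note NN = has_integral_NNJ[of L]
  have "((\<lambda>t. 2 * (cmod \<alpha>)\<^sup>2 * (cmod (p t))\<^sup>2 + 2 * (cmod \<beta>)\<^sup>2 * (cmod (m t))\<^sup>2 - 4 * Im (\<alpha> * cnj \<beta>) * j t)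
     has_integral 2 * (cmod \<alpha>)\<^sup>2 * Np L + 2 * (cmod \<beta>)\<^sup>2 * Nm L - 4 * Im (\<alpha> * cnj \<beta>) * J L) {0..L}"
    by (intro has_integral_diff has_integral_add has_integral_mult_right NN) (use L in auto)
  then show ?thesis
    by (rule has_integral_transform) (simp_all add: cmod_power2 j_def, algebra)
qed

section \<open>The perturbation error and the quadratic inequality\<close>

context
  fixes u v :: "real \<Rightarrow> complex"
  assumes u: "continuous_on {0..L} u" and v: "continuous_on {0..L} v"
begin

text \<open>The corrections, without the factor \<epsilon>, to the coefficients of \<open>p\<close>
  and \<open>m\<close> in variation of constants. The second component is taken as v =
  \<open>cnj \<xi>\<close> times that of the solution, so that the basis vectors become (p, cnj p)
  and (m, - cnj m).\<close>

definition "cp x = integral {0..x} (\<lambda>t. (u t * cnj (m t) - v t * m t) / 2)"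
definition "cm x = integral {0..x} (\<lambda>t. (u t * cnj (p t) + v t * p t) / 2)"
definition "S x = integral {0..x} (\<lambda>t. (cmod (u t))\<^sup>2 + (cmod (v t))\<^sup>2)"

lemma continuous_on_sub_uv:
  assumes "x \<in> {0..L}"
  shows "continuous_on {0..x} u" "continuous_on {0..x} v"
  using assms by (auto intro: continuous_on_subset[OF u] continuous_on_subset[OF v])

lemma S_mono: "x \<in> {0..L} \<Longrightarrow> S x \<le> S L"
  unfolding S_def
  by (intro integral_subset_le integrable_continuous_real continuous_intros continuous_on_sub_uv) (use L in auto)

text \<open>Each component of the error is an integral of (u, v) against one row of the kernel, (a,
  b) or (- cnj b, - cnj a). Cauchy-Schwarz is applied row by row.\<close>

lemma error_pointwise:
  assumes x: "x \<in> {0..L}"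
  shows "(cmod (cp x * p x + cm x * m x))\<^sup>2 + (cmod (cp x * cnj (p x) - cm x * cnj (m x)))\<^sup>2 \<le> kern x * S L"
proof -
  note c = continuous_on_sub[OF x] continuous_on_sub_uv[OF x]
  define a b where "a t = (p x * cnj (m t) + m x * cnj (p t)) / 2"
    and "b t = (m x * p t - p x * m t) / 2" for t
  have cab: "continuous_on {0..x} a" "continuous_on {0..x} b"
    unfolding a_def b_def by (intro continuous_intros c; simp)+
  have hp: "((\<lambda>t. (u t * cnj (m t) - v t * m t) / 2) has_integral cp x) {0..x}"
    and hm: "((\<lambda>t. (u t * cnj (p t) + v t * p t) / 2) has_integral cm x) {0..x}"
    unfolding cp_def cm_def by (intro integrable_integral integrable_continuous_real continuous_intros c; simp)+
  have "((\<lambda>t. a t * u t + b t * v t) has_integral cp x * p x + cm x * m x) {0..x}"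
    by (rule has_integral_transform[OF has_integral_add[OF has_integral_mult_left[OF hp, of "p x"] has_integral_mult_left[OF hm, of "m x"]]])
      (auto simp: a_def b_def field_simps)
  then have 1: "cp x * p x + cm x * m x = integral {0..x} (\<lambda>t. a t * u t + b t * v t)"
    by (simp add: integral_unique)
  have "((\<lambda>t. (- cnj (b t)) * u t + (- cnj (a t)) * v t) has_integral cp x * cnj (p x) - cm x * cnj (m x)) {0..x}"
    by (rule has_integral_transform[OF has_integral_diff[OF has_integral_mult_left[OF hp, of "cnj (p x)"] has_integral_mult_left[OF hm, of "cnj (m x)"]]])
      (auto simp: a_def b_def field_simps)
  then have 2: "cp x * cnj (p x) - cm x * cnj (m x) = integral {0..x} (\<lambda>t. (- cnj (b t)) * u t + (- cnj (a t)) * v t)"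
    by (simp add: integral_unique)
  have k: "integral {0..x} (\<lambda>t. (cmod (a t))\<^sup>2 + (cmod (b t))\<^sup>2) = kern x / 2"
    using integral_unique[OF kernel_entries[OF x]] by (simp add: a_def b_def)
  have "(cmod (cp x * p x + cm x * m x))\<^sup>2 \<le> kern x / 2 * S x"
    unfolding 1 using Cauchy_Schwarz_integral_pair[OF cab c(3,4)] k by (simp add: S_def)
  moreover have "(cmod (cp x * cnj (p x) - cm x * cnj (m x)))\<^sup>2 \<le> kern x / 2 * S x"
    unfolding 2
    using Cauchy_Schwarz_integral_pair[of 0 x "\<lambda>t. - cnj (b t)" "\<lambda>t. - cnj (a t)" u v] cab c k
    by (simp add: S_def continuous_on_cnj continuous_on_minus add.commute)
  moreover have "kern x * S x \<le> kern x * S L"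
    using kern_nonneg[OF x] S_mono[OF x] by (intro mult_left_mono) auto
  ultimately show ?thesis by linarith
qed

lemma cp_cm_continuous: "continuous_on {0..L} cp" "continuous_on {0..L} cm"
  unfolding cp_def cm_def
  by (intro indefinite_integral_continuous_1 integrable_continuous_real continuous_intros u v p m; simp)+

lemma error_integral:
  "integral {0..L} (\<lambda>x. (cmod (cp x * p x + cm x * m x))\<^sup>2 + (cmod (cp x * cnj (p x) - cm x * cnj (m x)))\<^sup>2)
    \<le> Np L * Nm L * S L"
proof -
  have S: "S L \<ge> 0"
    unfolding S_def by (intro integral_nonneg integrable_continuous_real continuous_intros u v) auto
  have "integral {0..L} (\<lambda>x. (cmod (cp x * p x + cm x * m x))\<^sup>2 + (cmod (cp x * cnj (p x) - cm x * cnj (m x)))\<^sup>2)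
    \<le> integral {0..L} (\<lambda>x. kern x * S L)"
    by (rule integral_le[OF _ has_integral_integrable[OF has_integral_mult_left[OF kern_has_integral]] error_pointwise])
      (intro integrable_continuous_real continuous_intros p m cp_cm_continuous)+
  also have "\<dots> = (Np L * Nm L - (J L)\<^sup>2) * S L"
    by (rule integral_unique[OF has_integral_mult_left[OF kern_has_integral]])
  also have "\<dots> \<le> Np L * Nm L * S L"
    using S by (intro mult_right_mono) auto
  finally show ?thesis .
qed

text \<open>The error has at most half the norm of \<open>(u, v)\<close>, so the unperturbed combination has at most
  \<open>3/2\<close> of it. The constant \<open>6\<close> is only reached because the cross term of that combination involves the
  imaginary part of \<open>\<alpha> * cnj \<beta>\<close> while the energy bound involves its real part.\<close>
lemma quadratic_bound:
  assumes eps: "\<epsilon> > 0" "2 * \<epsilon> * n = 1" "n\<^sup>2 = Np L * Nm L"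
    and fst: "\<And>x. x \<in> {0..L} \<Longrightarrow> u x = (\<alpha> + \<epsilon> * cp x) * p x + (\<beta> + \<epsilon> * cm x) * m x"
    and snd: "\<And>x. x \<in> {0..L} \<Longrightarrow> v x = (\<alpha> + \<epsilon> * cp x) * cnj (p x) - (\<beta> + \<epsilon> * cm x) * cnj (m x)"
    and energy: "2 * \<epsilon> * S L \<le> - 4 * Re (\<alpha> * cnj \<beta>)"
  shows "(cmod \<alpha>)\<^sup>2 * Np L + (cmod \<beta>)\<^sup>2 * Nm L \<le> 6 * cmod \<alpha> * cmod \<beta> * n"
proof -
  define E where "E x = (cmod (cp x * p x + cm x * m x))\<^sup>2 + (cmod (cp x * cnj (p x) - cm x * cnj (m x)))\<^sup>2" for x
  have "n > 0"
    using eps by (metis zero_less_mult_pos zero_less_one mult_pos_pos zero_less_numeral)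
  have E: "(E has_integral integral {0..L} E) {0..L}"
    unfolding E_def by (intro integrable_integral integrable_continuous_real continuous_intros p m cp_cm_continuous)
  have S: "((\<lambda>t. (cmod (u t))\<^sup>2 + (cmod (v t))\<^sup>2) has_integral S L) {0..L}"
    unfolding S_def by (intro integrable_integral integrable_continuous_real continuous_intros u v)
  \<comment> \<open>The weights are tuned to an error of half the norm: 3/2 + 3 * (1/2)^2 = 9/4 =
    (3/2)^2, the same constant as the triangle inequality in L2.\<close>
  have young: "(cmod (a - \<epsilon> * w))\<^sup>2 \<le> 3 / 2 * (cmod a)\<^sup>2 + 3 * \<epsilon>\<^sup>2 * (cmod w)\<^sup>2" for a w :: complex
  proof -
    have "0 \<le> (Re a + 2 * \<epsilon> * Re w)\<^sup>2 + (Im a + 2 * \<epsilon> * Im w)\<^sup>2" by simp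
    then show ?thesis unfolding cmod_power2 by (simp add: power2_eq_square algebra_simps)
  qed
  have "2 * (cmod \<alpha>)\<^sup>2 * Np L + 2 * (cmod \<beta>)\<^sup>2 * Nm L - 4 * Im (\<alpha> * cnj \<beta>) * J L
    \<le> 3 / 2 * S L + 3 * \<epsilon>\<^sup>2 * integral {0..L} E"
  proof (rule has_integral_le[OF combination_has_integral has_integral_add[OF has_integral_mult_right[OF S] has_integral_mult_right[OF E]]])
    fix x assume x: "x \<in> {0..L}"
    have eq: "\<alpha> * p x + \<beta> * m x = u x - \<epsilon> * (cp x * p x + cm x * m x)"
      "\<alpha> * cnj (p x) - \<beta> * cnj (m x) = v x - \<epsilon> * (cp x * cnj (p x) - cm x * cnj (m x))"
      using fst[OF x] snd[OF x] by (simp_all add: algebra_simps)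
    show "(cmod (\<alpha> * p x + \<beta> * m x))\<^sup>2 + (cmod (\<alpha> * cnj (p x) - \<beta> * cnj (m x)))\<^sup>2
      \<le> 3 / 2 * ((cmod (u x))\<^sup>2 + (cmod (v x))\<^sup>2) + 3 * \<epsilon>\<^sup>2 * E x"
      unfolding eq E_def
      by (rule order_trans[OF add_mono[OF young young]]) (simp add: algebra_simps)
  qed
  also have "\<dots> \<le> 3 / 2 * S L + 3 * \<epsilon>\<^sup>2 * (n\<^sup>2 * S L)"
    using error_integral eps by (intro add_left_mono mult_left_mono) (auto simp: E_def[abs_def])
  also have "\<dots> = 3 / 2 * S L + 3 / 4 * (2 * \<epsilon> * n)\<^sup>2 * S L"
    by (simp add: power2_eq_square)
  \<comment> \<open>Since \<open>2 * \<epsilon> * n = 1\<close>, its powers may be exchanged. One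
    factor is kept so that \<epsilon> joins \<open>S L\<close> to form the energy term.\<close>
  also have "\<dots> = 9 / 4 * (2 * \<epsilon> * n) * S L" by (simp add: eps)
  also have "\<dots> = 9 / 4 * n * (2 * \<epsilon> * S L)" by simp
  also have "\<dots> \<le> 9 / 4 * n * (- 4 * Re (\<alpha> * cnj \<beta>))"
    using energy \<open>n > 0\<close> by (intro mult_left_mono) auto
  also have "\<dots> = - 9 * Re (\<alpha> * cnj \<beta>) * n"
    by simp
  finally have "2 * (cmod \<alpha>)\<^sup>2 * Np L + 2 * (cmod \<beta>)\<^sup>2 * Nm L
      \<le> 4 * Im (\<alpha> * cnj \<beta>) * J L - 9 * Re (\<alpha> * cnj \<beta>) * n" by linarith
  also have "\<dots> \<le> 4 * \<bar>Im (\<alpha> * cnj \<beta>)\<bar> * n + 9 * \<bar>Re (\<alpha> * cnj \<beta>)\<bar> * n"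
  proof -
    have "\<bar>J L\<bar> \<le> n" using J_sq_le \<open>n > 0\<close> eps
      by (subst power2_le_iff_abs_le[symmetric]) auto
    then have "\<bar>Im (\<alpha> * cnj \<beta>)\<bar> * \<bar>J L\<bar> \<le> \<bar>Im (\<alpha> * cnj \<beta>)\<bar> * n" by (intro mult_left_mono) auto
    then have "Im (\<alpha> * cnj \<beta>) * J L \<le> \<bar>Im (\<alpha> * cnj \<beta>)\<bar> * n"
      by (metis abs_mult abs_ge_self order_trans)
    moreover have "- Re (\<alpha> * cnj \<beta>) * n \<le> \<bar>Re (\<alpha> * cnj \<beta>)\<bar> * n"
      using \<open>n > 0\<close> by (intro mult_right_mono) auto
    ultimately show ?thesis by linarith
  qed
  also have "\<dots> = (4 * \<bar>Im (\<alpha> * cnj \<beta>)\<bar> + 9 * \<bar>Re (\<alpha> * cnj \<beta>)\<bar>) * n" by (simp add: algebra_simps)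
  also have "\<dots> \<le> 12 * cmod (\<alpha> * cnj \<beta>) * n"
  proof (rule mult_right_mono[OF power2_le_imp_le])
    \<comment> \<open>Cauchy-Schwarz would give the constant 16 + 81 = 97; rounding up to 144 = 12^2
      leaves 47 times the sum of squares to spare. Halving 12 gives the final 6.\<close>
    have *: "(4 * a + 9 * b)\<^sup>2 \<le> 144 * (b\<^sup>2 + a\<^sup>2)" for a b :: real
    proof -
      have "0 \<le> (9 * a - 4 * b)\<^sup>2 + 47 * (a\<^sup>2 + b\<^sup>2)" by simp
      also have "\<dots> = 144 * (b\<^sup>2 + a\<^sup>2) - (4 * a + 9 * b)\<^sup>2"
        by algebra
      finally show ?thesis by simp
    qed
    show "(4 * \<bar>Im (\<alpha> * cnj \<beta>)\<bar> + 9 * \<bar>Re (\<alpha> * cnj \<beta>)\<bar>)\<^sup>2 \<le> (12 * cmod (\<alpha> * cnj \<beta>))\<^sup>2"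
      using *[of "\<bar>Im (\<alpha> * cnj \<beta>)\<bar>" "\<bar>Re (\<alpha> * cnj \<beta>)\<bar>"] unfolding power_mult_distrib cmod_power2 by simp
  qed (use \<open>n > 0\<close> in auto)
  finally show ?thesis by (simp add: norm_mult)
qed

end

end

section \<open>Bounds for the Schur function and subordinacy\<close>

text \<open>After division by the square of Y, the quotient lies between the roots 3 - sqrt 8 and 3
  + sqrt 8 of t^2 - 6 t + 1.\<close>

lemma ratio_bounds:
  fixes X Y :: real
  assumes "X\<^sup>2 + Y\<^sup>2 \<le> 6 * X * Y" "Y > 0"
  shows "3 - sqrt 8 \<le> X / Y" "X / Y \<le> 3 + sqrt 8"
proof -
  have "(X / Y - 3)\<^sup>2 \<le> 8"
    using assms by (simp add: field_simps power2_eq_square)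
  then have "\<bar>X / Y - 3\<bar> \<le> sqrt 8" by (metis real_sqrt_abs real_sqrt_le_mono)
  then show "3 - sqrt 8 \<le> X / Y" "X / Y \<le> 3 + sqrt 8" by auto
qed

lemma normL_sq: "continuous_on {0..L} f \<Longrightarrow> (normL L f)\<^sup>2 = integral {0..L} (\<lambda>x. (norm (f x))\<^sup>2)"
  unfolding normL_def
  by (subst real_sqrt_pow2) (auto intro!: integral_nonneg integrable_continuous_real continuous_intros)

lemma normL_mono:
  assumes "\<And>L. continuous_on {0..L} f" "L \<le> M"
  shows "normL L f \<le> normL M f"
  unfolding normL_def using assms
  by (intro real_sqrt_le_mono integral_subset_le integrable_continuous_real continuous_intros) auto

lemma normL_pos:
  assumes "continuous_on {0..L} f" "f 0 \<noteq> 0" "L > 0"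
  shows "normL L f > 0"
proof -
  have "integral {0..L} (\<lambda>x. (norm (f x))\<^sup>2) \<noteq> 0"
    using assms by (subst integral_eq_0_iff) (auto intro!: continuous_intros)
  moreover have "integral {0..L} (\<lambda>x. (norm (f x))\<^sup>2) \<ge> 0"
    by (intro integral_nonneg integrable_continuous_real continuous_intros assms) auto
  ultimately show ?thesis by (simp add: normL_def)
qed

lemma normL_nonneg:
  assumes "\<And>L. continuous_on {0..L} f"
  shows "0 \<le> normL L f"
proof -
  have "0 \<le> integral {0..L} (\<lambda>x. (norm (f x))\<^sup>2)"
    by (rule integral_nonneg) (auto intro!: integrable_continuous_real continuous_intros assms)
  then show ?thesis by (simp add: normL_def)
qed

lemma normL_continuous:
  assumes "\<And>L. continuous_on {0..L} f"
  shows "continuous_on {0..M} (\<lambda>L. normL L f)"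
proof -
  have "continuous_on {0..M} (\<lambda>L. integral {0..L} (\<lambda>x. (norm (f x))\<^sup>2))"
    by (rule indefinite_integral_continuous_1) (intro integrable_continuous_real continuous_intros assms)
  then show ?thesis unfolding normL_def by (rule continuous_on_real_sqrt)
qed

context dirac_system
begin

section \<open>Boundary solutions at a real spectral parameter and their perturbation\<close>

definition fst_sol :: "real \<Rightarrow> complex \<Rightarrow> real \<Rightarrow> complex" where
  "fst_sol lam \<eta> x = fst (sol \<phi> (of_real lam) (1, \<eta>) x)"

lemma fst_sol_eq: "fst_sol lam \<eta> x = Aent \<phi> lam x + \<eta> * Bent \<phi> lam x"
  using sol_linear[of "of_real lam" 1 1 \<eta> 0 0 1 x] by (simp add: fst_sol_def Aent_def Bent_def)

lemma fst_sol_0: "fst_sol lam \<eta> 0 = 1"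
  by (simp add: fst_sol_def sol_0)

lemma fst_sol_continuous: "continuous_on {0..L} (fst_sol lam \<eta>)"
  unfolding fst_sol_def by (intro continuous_on_fst continuous_on_is_sol[OF sol_is_sol])

text \<open>For unimodular \<eta>, the conjugate swap followed by multiplication by \<eta> maps
  solutions at real \<open>lam\<close> to solutions and fixes the initial value (1, \<eta>).
  Uniqueness then fixes the solution.\<close>

lemma sol_boundary:
  assumes "cmod \<eta> = 1"
  shows "sol \<phi> (of_real lam) (1, \<eta>) x = (fst_sol lam \<eta> x, \<eta> * cnj (fst_sol lam \<eta> x))"
proof -
  let ?W = "sol \<phi> (of_real lam) (1, \<eta>)"
  have \<eta>: "\<eta> * cnj \<eta> = 1" using assms by (simp add: complex_norm_square[symmetric])
  have "is_sol \<phi> (of_real lam) (\<lambda>x. (\<eta> * fst (cnj (snd (?W x)), cnj (fst (?W x))),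
      \<eta> * snd (cnj (snd (?W x)), cnj (fst (?W x)))))"
    using is_sol_scale[OF is_sol_cnj_swap[OF sol_is_sol[of "of_real lam" "(1, \<eta>)"]], of \<eta>] by simp
  from sol_unique[OF this] have "?W x = (\<eta> * cnj (snd (?W x)), \<eta> * cnj (fst (?W x)))"
    by (simp add: sol_0 \<eta> fun_eq_iff)
  from arg_cong[OF this, of snd] have "snd (?W x) = \<eta> * cnj (fst (?W x))"
    by (simp only: snd_conv)
  then show ?thesis by (simp add: fst_sol_def prod_eq_iff)
qed

text \<open>Constancy of the Wronskian of the solutions starting at (1, \<xi>) and (1, - \<xi>). It
  provides the determinant for variation of constants and the lower bound on
  \<open>norm_product\<close>.\<close>

lemma Re_fst_sol_mult_cnj:
  assumes "cmod \<xi> = 1" "x \<ge> 0"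
  shows "Re (fst_sol lam \<xi> x * cnj (fst_sol lam (- \<xi>) x)) = 1"
proof -
  let ?p = "fst_sol lam \<xi> x" and ?m = "fst_sol lam (- \<xi>) x"
  have "cmod (- \<xi>) = 1" using assms by simp
  from has_integral_unique[OF wronskian_has_integral[OF sol_is_sol[of "of_real lam" "(1, \<xi>)"]
        sol_is_sol[of "of_real lam" "(1, - \<xi>)"] \<open>x \<ge> 0\<close>], of 0]
  have "\<xi> * (?p * cnj ?m + cnj ?p * ?m) = \<xi> * 2"
    by (simp add: sol_boundary[OF assms(1)] sol_boundary[OF \<open>cmod (- \<xi>) = 1\<close>] fst_sol_0 algebra_simps)
  moreover have "\<xi> \<noteq> 0" using assms by auto
  ultimately have "?p * cnj ?m + cnj ?p * ?m = 2" by simp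
  from arg_cong[OF this, of Re] show ?thesis by simp
qed

text \<open>The Wronskians of \<Psi> with the two boundary solutions isolate its two coefficients.
  Here \<alpha> and \<beta> are the coordinates of (s, 1) in the basis (1, \<xi>), (1, -
  \<xi>).\<close>

lemma variation_of_constants:
  fixes \<epsilon> :: real and p m u v cp cm :: "real \<Rightarrow> complex"
  assumes \<xi>: "cmod \<xi> = 1" and \<Psi>: "is_sol \<phi> (of_real lam + \<i> * of_real \<epsilon>) \<Psi>" "\<Psi> 0 = (s, 1)"
    and x: "x \<in> {0..L}"
  defines "p \<equiv> fst_sol lam \<xi>" and "m \<equiv> fst_sol lam (- \<xi>)"
    and "u \<equiv> \<lambda>x. fst (\<Psi> x)" and "v \<equiv> \<lambda>x. cnj \<xi> * snd (\<Psi> x)"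
    and "\<alpha> \<equiv> (s + cnj \<xi>) / 2" and "\<beta> \<equiv> (s - cnj \<xi>) / 2"
  defines cp: "cp \<equiv> solution_pair.cp m u v" and cm: "cm \<equiv> solution_pair.cm p u v"
  shows "u x = (\<alpha> + \<epsilon> * cp x) * p x + (\<beta> + \<epsilon> * cm x) * m x"
    and "v x = (\<alpha> + \<epsilon> * cp x) * cnj (p x) - (\<beta> + \<epsilon> * cm x) * cnj (m x)"
proof -
  have L: "0 \<le> L" and x0: "x \<ge> 0" using x by auto
  have \<xi>1: "\<xi> * cnj \<xi> = 1" and "\<xi> \<noteq> 0" and "cmod (- \<xi>) = 1"
    using \<xi> by (auto simp: complex_norm_square[symmetric])
  have fstu: "fst (\<Psi> t) = u t" for t by (simp add: u_def)
  have fst_sol: "fst_sol lam \<xi> t = p t" "fst_sol lam (- \<xi>) t = m t" "p 0 = 1" "m 0 = 1" for t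
    by (simp_all add: p_def m_def fst_sol_0)
  have sndv: "snd (\<Psi> t) = \<xi> * v t" for t using \<xi>1 by (simp add: v_def flip: mult.assoc)
  have pm: "continuous_on {0..L} p" "continuous_on {0..L} m"
    by (simp_all add: p_def m_def fst_sol_continuous)
  interpret solution_pair p m L by unfold_locales (use pm L in auto)
  have uv: "continuous_on {0..L} u" "continuous_on {0..L} v" unfolding u_def v_def
    by (intro continuous_intros continuous_on_fst continuous_on_snd continuous_on_is_sol[OF \<Psi>(1)])+
  have uv': "continuous_on {0..x} u" "continuous_on {0..x} v"
    unfolding u_def v_def
    by (intro continuous_intros continuous_on_fst continuous_on_snd continuous_on_is_sol[OF \<Psi>(1)])+
  have hp: "((\<lambda>t. (u t * cnj (m t) - v t * m t) / 2) has_integral cp x) {0..x}"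
    and hm: "((\<lambda>t. (u t * cnj (p t) + v t * p t) / 2) has_integral cm x) {0..x}"
    unfolding cp cm cp_def[OF uv] cm_def[OF uv]
    by (intro integrable_integral integrable_continuous_real continuous_intros continuous_on_sub[OF x] uv'; simp)+
  \<comment> \<open>The Wronskian with the solution from (1, - \<xi>) is - \<xi> times this
    expression. The spectral difference enters as \<i> * (- \<i> * \<epsilon>) = \<epsilon>.\<close>
  have 1: "u x * cnj (m x) + v x * m x = 2 * \<alpha> + 2 * \<epsilon> * cp x"
  proof -
    have "((\<lambda>t. (- 2 * \<xi> * \<epsilon>) * ((u t * cnj (m t) - v t * m t) / 2)) has_integral
        - \<xi> * (u x * cnj (m x) + v x * m x) + \<xi> * (s + cnj \<xi>)) {0..x}"
      by (rule has_integral_transform[OF wronskian_has_integral[OF \<Psi>(1) sol_is_sol[of "of_real lam" "(1, - \<xi>)"] x0]])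
        (simp_all add: sol_boundary[OF \<open>cmod (- \<xi>) = 1\<close>] fst_sol \<Psi>(2) fstu[symmetric] sndv \<xi>1 algebra_simps)
    from has_integral_unique[OF this has_integral_mult_right[OF hp]]
    have "\<xi> * (u x * cnj (m x) + v x * m x) = \<xi> * (s + cnj \<xi> + 2 * \<epsilon> * cp x)"
      by (simp add: algebra_simps)
    then show ?thesis using \<open>\<xi> \<noteq> 0\<close> by (simp add: \<alpha>_def)
  qed
  have 2: "u x * cnj (p x) - v x * p x = 2 * \<beta> + 2 * \<epsilon> * cm x"
  proof -
    have "((\<lambda>t. (2 * \<xi> * \<epsilon>) * ((u t * cnj (p t) + v t * p t) / 2)) has_integral
        \<xi> * (u x * cnj (p x) - v x * p x) - \<xi> * (s - cnj \<xi>)) {0..x}"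
      by (rule has_integral_transform[OF wronskian_has_integral[OF \<Psi>(1) sol_is_sol[of "of_real lam" "(1, \<xi>)"] x0]])
        (simp_all add: sol_boundary[OF \<xi>] fst_sol \<Psi>(2) fstu[symmetric] sndv \<xi>1 algebra_simps)
    from has_integral_unique[OF this has_integral_mult_right[OF hm]]
    have "\<xi> * (u x * cnj (p x) - v x * p x) = \<xi> * (s - cnj \<xi> + 2 * \<epsilon> * cm x)"
      by (simp add: algebra_simps)
    then show ?thesis using \<open>\<xi> \<noteq> 0\<close> by (simp add: \<beta>_def)
  qed
  have "Re (p x * cnj (m x)) = 1" unfolding p_def m_def by (rule Re_fst_sol_mult_cnj[OF \<xi> x0])
  then have 3: "p x * cnj (m x) + cnj (p x) * m x = 2" by (simp add: complex_eq_iff)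
  \<comment> \<open>Cramer's rule for the system formed by 1 and 2, with determinant 2 by 3.\<close>
  have "u x * (p x * cnj (m x) + cnj (p x) * m x)
      = (u x * cnj (m x) + v x * m x) * p x + (u x * cnj (p x) - v x * p x) * m x"
    by (simp add: algebra_simps)
  then have "2 * u x = 2 * ((\<alpha> + \<epsilon> * cp x) * p x + (\<beta> + \<epsilon> * cm x) * m x)"
    unfolding 1 2 3 by (simp add: algebra_simps)
  then show "u x = (\<alpha> + \<epsilon> * cp x) * p x + (\<beta> + \<epsilon> * cm x) * m x"
    by (simp only: mult_cancel_left) simp
  have "v x * (p x * cnj (m x) + cnj (p x) * m x)
      = (u x * cnj (m x) + v x * m x) * cnj (p x) - (u x * cnj (p x) - v x * p x) * cnj (m x)"
    by (simp add: algebra_simps)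
  then have "2 * v x = 2 * ((\<alpha> + \<epsilon> * cp x) * cnj (p x) - (\<beta> + \<epsilon> * cm x) * cnj (m x))"
    unfolding 1 2 3 by (simp add: algebra_simps)
  then show "v x = (\<alpha> + \<epsilon> * cp x) * cnj (p x) - (\<beta> + \<epsilon> * cm x) * cnj (m x)"
    by (simp only: mult_cancel_left) simp
qed

lemma schur_ratio_bounds:
  fixes lam :: real
  assumes \<xi>: "cmod \<xi> = 1" and "L > 0"
  defines "np \<equiv> normL L (fst_sol lam \<xi>)" and "nm \<equiv> normL L (fst_sol lam (- \<xi>))"
  defines "s \<equiv> schur \<phi> (of_real lam + \<i> * of_real (1 / (2 * np * nm)))"
  shows "(3 - sqrt 8) * (nm / np) \<le> cmod ((1 + \<xi> * s) / (1 - \<xi> * s))"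
    and "cmod ((1 + \<xi> * s) / (1 - \<xi> * s)) \<le> (3 + sqrt 8) * (nm / np)"
proof -
  define \<epsilon> where "\<epsilon> = 1 / (2 * np * nm)"
  have \<xi>1: "\<xi> * cnj \<xi> = 1" using \<xi> by (simp add: complex_norm_square[symmetric])
  have n: "np > 0" "nm > 0"
    unfolding np_def nm_def by (rule normL_pos; simp add: fst_sol_continuous fst_sol_0 \<open>L > 0\<close>)+
  then have "\<epsilon> > 0" by (simp add: \<epsilon>_def)
  define z where "z = complex_of_real lam + \<i> * of_real \<epsilon>"
  have z: "Im z = \<epsilon>" and "Im z > 0" using \<open>\<epsilon> > 0\<close> by (simp_all add: z_def)
  have sz: "s = schur \<phi> z" by (simp add: s_def z_def \<epsilon>_def)
  obtain \<Psi> where \<Psi>': "is_sol \<phi> z \<Psi>" "\<Psi> 0 = (schur \<phi> z, 1)" "cmod (schur \<phi> z) < 1"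
    "\<forall>L\<ge>0. 2 * Im z * integral {0..L} (\<lambda>x. (norm (\<Psi> x))\<^sup>2) \<le> 1 - (cmod (schur \<phi> z))\<^sup>2"
    using schur_weyl_solution[OF \<open>Im z > 0\<close>] by blast
  note \<Psi> = \<Psi>'(1,2)[folded sz, unfolded z_def] and s = \<Psi>'(3)[folded sz]
  have energy: "2 * \<epsilon> * integral {0..L} (\<lambda>x. (norm (\<Psi> x))\<^sup>2) \<le> 1 - (cmod s)\<^sup>2"
    using \<Psi>'(4) \<open>L > 0\<close> by (simp add: z sz)
  define p m u v where "p = fst_sol lam \<xi>" and "m = fst_sol lam (- \<xi>)"
    and "u = (\<lambda>x. fst (\<Psi> x))" and "v = (\<lambda>x. cnj \<xi> * snd (\<Psi> x))"
  define \<alpha> \<beta> where "\<alpha> = (s + cnj \<xi>) / 2" and "\<beta> = (s - cnj \<xi>) / 2"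
  interpret solution_pair p m L
    by unfold_locales (use \<open>L > 0\<close> in \<open>auto simp: p_def m_def fst_sol_continuous\<close>)
  have uv: "continuous_on {0..L} u" "continuous_on {0..L} v" unfolding u_def v_def
    by (intro continuous_intros continuous_on_fst continuous_on_snd continuous_on_is_sol[OF \<Psi>(1)])+
  have N: "Np L = np\<^sup>2" "Nm L = nm\<^sup>2"
    unfolding Np_def Nm_def np_def nm_def normL_sq[OF fst_sol_continuous] by (simp_all only: p_def m_def)
  have "S u v L = integral {0..L} (\<lambda>x. (norm (\<Psi> x))\<^sup>2)"
    unfolding S_def[OF uv] by (simp add: u_def v_def norm_mult \<xi> norm_pair_sq)
  moreover have "1 - (cmod s)\<^sup>2 = - 4 * Re (\<alpha> * cnj \<beta>)"
  proof -
    \<comment> \<open>The last bracket is purely imaginary, so the real part is that of s * cnj s -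
      1.\<close>
    have "4 * (\<alpha> * cnj \<beta>) = s * cnj s - \<xi> * cnj \<xi> + (cnj (\<xi> * s) - \<xi> * s)"
      by (simp add: \<alpha>_def \<beta>_def field_simps)
    then have "4 * (\<alpha> * cnj \<beta>) = of_real ((cmod s)\<^sup>2 - 1) + (cnj (\<xi> * s) - \<xi> * s)"
      by (simp only: \<xi>1 complex_norm_square[of s, symmetric] of_real_diff of_real_1)
    from arg_cong[OF this, of Re] show ?thesis by simp
  qed
  ultimately have en: "2 * \<epsilon> * S u v L \<le> - 4 * Re (\<alpha> * cnj \<beta>)" using energy by simp
  have "(cmod \<alpha>)\<^sup>2 * Np L + (cmod \<beta>)\<^sup>2 * Nm L \<le> 6 * cmod \<alpha> * cmod \<beta> * (np * nm)"
  proof (rule quadratic_bound[OF uv \<open>\<epsilon> > 0\<close> _ _ _ _ en])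
    show "2 * \<epsilon> * (np * nm) = 1" using n by (simp add: \<epsilon>_def)
    show "(np * nm)\<^sup>2 = Np L * Nm L" by (simp add: N power_mult_distrib)
    show "u x = (\<alpha> + \<epsilon> * cp u v x) * p x + (\<beta> + \<epsilon> * cm u v x) * m x"
      and "v x = (\<alpha> + \<epsilon> * cp u v x) * cnj (p x) - (\<beta> + \<epsilon> * cm u v x) * cnj (m x)"
      if "x \<in> {0..L}" for x
    proof -
      have "fst (\<Psi> x) = u x" "cnj \<xi> * snd (\<Psi> x) = v x" by (simp_all add: u_def v_def)
      note vc = variation_of_constants[OF \<xi> \<Psi> that, folded p_def m_def u_def v_def \<alpha>_def \<beta>_def, unfolded this]
      show "u x = (\<alpha> + \<epsilon> * cp u v x) * p x + (\<beta> + \<epsilon> * cm u v x) * m x"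
        by (rule vc(1))
      show "v x = (\<alpha> + \<epsilon> * cp u v x) * cnj (p x) - (\<beta> + \<epsilon> * cm u v x) * cnj (m x)"
        by (rule vc(2))
    qed
  qed
  then have quad: "(cmod \<alpha> * np)\<^sup>2 + (cmod \<beta> * nm)\<^sup>2 \<le> 6 * (cmod \<alpha> * np) * (cmod \<beta> * nm)"
    by (simp add: N power_mult_distrib mult_ac)
  have "1 + \<xi> * s = \<xi> * (2 * \<alpha>)" "1 - \<xi> * s = - (\<xi> * (2 * \<beta>))"
    by (simp_all add: \<alpha>_def \<beta>_def field_simps \<xi>1)
  then have ab: "cmod (1 + \<xi> * s) = 2 * cmod \<alpha>" "cmod (1 - \<xi> * s) = 2 * cmod \<beta>"
    by (simp_all only: norm_minus_cancel norm_mult \<xi> norm_numeral mult_1)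
  \<comment> \<open>Strict contractivity keeps \<beta> away from 0, so the Cayley quotient has a
    nonzero denominator.\<close>
  have "cmod (\<xi> * s) < 1" using s by (simp add: norm_mult \<xi>)
  moreover have "1 - cmod (\<xi> * s) \<le> 2 * cmod \<beta>"
    using norm_triangle_ineq2[of 1 "\<xi> * s"] unfolding ab norm_one .
  ultimately have "cmod \<beta> > 0" by linarith
  have q: "cmod ((1 + \<xi> * s) / (1 - \<xi> * s)) = cmod \<alpha> * np / (cmod \<beta> * nm) * (nm / np)"
    using n by (simp add: norm_divide ab)
  have "cmod \<beta> * nm > 0" using \<open>cmod \<beta> > 0\<close> n by simp
  note rb = ratio_bounds[OF quad this]
  show "(3 - sqrt 8) * (nm / np) \<le> cmod ((1 + \<xi> * s) / (1 - \<xi> * s))"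
    and "cmod ((1 + \<xi> * s) / (1 - \<xi> * s)) \<le> (3 + sqrt 8) * (nm / np)"
    unfolding q by (rule mult_right_mono[OF rb(1)] mult_right_mono[OF rb(2)]; use n in simp)+
qed

section \<open>The correspondence between L and \<epsilon>, and the exchange of limits\<close>

definition ratio :: "real \<Rightarrow> complex \<Rightarrow> real \<Rightarrow> real" where
  "ratio lam \<xi> L = normL L (fst_sol lam (- \<xi>)) / normL L (fst_sol lam \<xi>)"

definition norm_product :: "real \<Rightarrow> complex \<Rightarrow> real \<Rightarrow> real" where
  "norm_product lam \<xi> L = normL L (fst_sol lam \<xi>) * normL L (fst_sol lam (- \<xi>))"

lemma normL_fst_sol_pos: "L > 0 \<Longrightarrow> normL L (fst_sol lam \<eta>) > 0"
  using normL_pos[OF fst_sol_continuous] by (simp add: fst_sol_0)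

lemma norm_product_mono: "0 \<le> L \<Longrightarrow> L \<le> M \<Longrightarrow> norm_product lam \<xi> L \<le> norm_product lam \<xi> M"
  unfolding norm_product_def
  by (rule mult_mono) (simp_all add: normL_mono normL_nonneg fst_sol_continuous)

text \<open>Since the real part of \<open>p * cnj m\<close> is 1, the product of the moduli is at
  least 1; integrate and apply Cauchy-Schwarz.\<close>

lemma norm_product_ge:
  assumes \<xi>: "cmod \<xi> = 1" and "L \<ge> 0"
  shows "L \<le> norm_product lam \<xi> L"
proof -
  let ?p = "fst_sol lam \<xi>" and ?m = "fst_sol lam (- \<xi>)"
  have c: "continuous_on {0..L} (\<lambda>x. cmod (?p x))" "continuous_on {0..L} (\<lambda>x. cmod (?m x))"
    by (intro continuous_intros fst_sol_continuous)+
  have "integral {0..L} (\<lambda>x. 1) \<le> integral {0..L} (\<lambda>x. cmod (?p x) * cmod (?m x))"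
  proof (rule integral_le)
    fix x assume "x \<in> {0..L}"
    then have "1 = Re (?p x * cnj (?m x))" using Re_fst_sol_mult_cnj[OF \<xi>, of x lam] by simp
    also have "\<dots> \<le> cmod (?p x * cnj (?m x))" by (rule complex_Re_le_cmod)
    finally show "1 \<le> cmod (?p x) * cmod (?m x)" by (simp add: norm_mult)
  qed (intro integrable_continuous_real continuous_intros c)+
  then have "L\<^sup>2 \<le> (integral {0..L} (\<lambda>x. cmod (?p x) * cmod (?m x)))\<^sup>2"
    using \<open>L \<ge> 0\<close> by (intro power_mono) auto
  also have "\<dots> \<le> (norm_product lam \<xi> L)\<^sup>2"
    using Cauchy_Schwarz_integral[OF c] by (simp add: norm_product_def power_mult_distrib normL_sq fst_sol_continuous)
  finally show ?thesis
    by (rule power2_le_imp_le) (auto simp: norm_product_def intro!: mult_nonneg_nonneg normL_nonneg fst_sol_continuous)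
qed

text \<open>Intermediate value theorem on [0, y]: the product vanishes at 0 and is at least y at y
  by \<open>norm_product_ge\<close>.\<close>

lemma ex_norm_product_eq:
  assumes "cmod \<xi> = 1" "y > 0"
  shows "\<exists>L>0. norm_product lam \<xi> L = y"
proof -
  have "\<exists>L\<ge>0. L \<le> y \<and> norm_product lam \<xi> L = y"
  proof (rule IVT')
    show "norm_product lam \<xi> 0 \<le> y" using assms by (simp add: norm_product_def normL_def)
    show "y \<le> norm_product lam \<xi> y" using norm_product_ge assms by simp
    show "continuous_on {0..y} (norm_product lam \<xi>)"
      unfolding norm_product_def by (intro continuous_on_mult normL_continuous fst_sol_continuous)
  qed (use assms in auto)
  then obtain L where L: "L \<ge> 0" "norm_product lam \<xi> L = y" by blast
  have "L \<noteq> 0" using L assms by (auto simp: norm_product_def normL_def)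
  with L have "L > 0" by simp
  with L(2) show ?thesis by blast
qed

lemma filterlim_norm_product:
  assumes "cmod \<xi> = 1"
  shows "filterlim (\<lambda>L. 1 / (2 * norm_product lam \<xi> L)) (at_right 0) at_top"
proof -
  have "filterlim (\<lambda>L. norm_product lam \<xi> L) at_top at_top"
  proof (rule filterlim_at_top_mono[OF filterlim_ident])
    show "\<forall>\<^sub>F L in at_top. L \<le> norm_product lam \<xi> L"
      by (rule eventually_mono[OF eventually_ge_at_top[of 0] norm_product_ge[OF assms]])
  qed
  then have "filterlim (\<lambda>L. 2 * norm_product lam \<xi> L) at_top at_top"
    by (intro filterlim_tendsto_pos_mult_at_top[OF tendsto_const]) auto
  then show ?thesis
    using filterlim_compose[OF filterlim_inverse_at_right_top] by (simp add: inverse_eq_divide)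
qed

text \<open>As \<open>L\<close> runs through \<open>(0, \<infinity>)\<close>, \<open>1 / (2 * norm_product lam \<xi> L)\<close> runs through \<open>(0, \<infinity>)\<close>
  in the opposite direction, so the two limits can be exchanged.\<close>
lemma filterlim_norm_product_iff:
  fixes f :: "real \<Rightarrow> real"
  assumes \<xi>: "cmod \<xi> = 1"
  shows "filterlim (\<lambda>L. f (1 / (2 * norm_product lam \<xi> L))) at_top at_top \<longleftrightarrow> filterlim f at_top (at_right 0)"
proof
  assume "filterlim f at_top (at_right 0)"
  then show "filterlim (\<lambda>L. f (1 / (2 * norm_product lam \<xi> L))) at_top at_top"
    using filterlim_compose filterlim_norm_product[OF \<xi>] by blast
next
  assume lim: "filterlim (\<lambda>L. f (1 / (2 * norm_product lam \<xi> L))) at_top at_top"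
  show "filterlim f at_top (at_right 0)"
    unfolding filterlim_at_top
  proof
    fix Z
    obtain L0 where L0: "\<And>L. L \<ge> L0 \<Longrightarrow> Z \<le> f (1 / (2 * norm_product lam \<xi> L))"
      using lim by (auto simp: filterlim_at_top eventually_at_top_linorder)
    define M where "M = max L0 1"
    have M: "M \<ge> L0" "M > 0" by (auto simp: M_def)
    have sM: "norm_product lam \<xi> M > 0" using norm_product_ge[OF \<xi>, of M lam] M by simp
    show "\<forall>\<^sub>F e in at_right 0. Z \<le> f e"
      unfolding eventually_at_right_field
    proof (intro exI conjI allI impI)
      show "0 < 1 / (2 * norm_product lam \<xi> M)" using sM by simp
      fix e assume e: "0 < e" "e < 1 / (2 * norm_product lam \<xi> M)"
      \<comment> \<open>Every small e comes from some L. Monotonicity of the product shows that this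
        L exceeds M, so the bound known for large L applies.\<close>
      obtain L where L: "L > 0" "norm_product lam \<xi> L = 1 / (2 * e)"
        using ex_norm_product_eq[OF \<xi>, of "1 / (2 * e)" lam] e by auto
      have "2 * e * norm_product lam \<xi> M < 2 * e * norm_product lam \<xi> L"
        using e sM L by (simp add: field_simps)
      then have "norm_product lam \<xi> M < norm_product lam \<xi> L" using e by simp
      then have "L > M" using norm_product_mono[of L M lam \<xi>] L by linarith
      then show "Z \<le> f e" using L0[of L] L M e by simp
    qed
  qed
qed

definition cayley :: "real \<Rightarrow> complex \<Rightarrow> real \<Rightarrow> real" where
  "cayley lam \<xi> e = (let s = schur \<phi> (of_real lam + \<i> * of_real e) in cmod ((1 + \<xi> * s) / (1 - \<xi> * s)))"

lemma cayley_bounds: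
  assumes "cmod \<xi> = 1" "L > 0"
  shows "(3 - sqrt 8) * ratio lam \<xi> L \<le> cayley lam \<xi> (1 / (2 * norm_product lam \<xi> L))"
    and "cayley lam \<xi> (1 / (2 * norm_product lam \<xi> L)) \<le> (3 + sqrt 8) * ratio lam \<xi> L"
  using schur_ratio_bounds[OF assms, of lam]
  unfolding cayley_def ratio_def norm_product_def Let_def mult.assoc by blast+

text \<open>As 8 < 9, both constants in the two-sided bound are positive, so divergence passes
  either way along L; \<open>filterlim_norm_product_iff\<close> then replaces L by e.\<close>

lemma ratio_iff_cayley:
  assumes \<xi>: "cmod \<xi> = 1"
  shows "filterlim (ratio lam \<xi>) at_top at_top \<longleftrightarrow> filterlim (cayley lam \<xi>) at_top (at_right 0)"
proof -
  have "sqrt 8 < sqrt 9" by (intro real_sqrt_less_mono) simp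
  then have pos: "3 - sqrt 8 > 0" by simp
  then have pos': "3 + sqrt 8 > 0" by (simp add: add_pos_nonneg)
  let ?c = "\<lambda>L. cayley lam \<xi> (1 / (2 * norm_product lam \<xi> L))"
  have "filterlim (ratio lam \<xi>) at_top at_top \<longleftrightarrow> filterlim ?c at_top at_top"
  proof
    assume "filterlim (ratio lam \<xi>) at_top at_top"
    then have "filterlim (\<lambda>L. (3 - sqrt 8) * ratio lam \<xi> L) at_top at_top"
      using pos by (intro filterlim_tendsto_pos_mult_at_top[OF tendsto_const])
    then show "filterlim ?c at_top at_top"
      by (rule filterlim_at_top_mono)
        (intro eventually_mono[OF eventually_gt_at_top[of 0]] cayley_bounds \<xi>)
  next
    assume "filterlim ?c at_top at_top"
    then have "filterlim (\<lambda>L. inverse (3 + sqrt 8) * ?c L) at_top at_top"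
      using pos' by (intro filterlim_tendsto_pos_mult_at_top[OF tendsto_const]) auto
    then show "filterlim (ratio lam \<xi>) at_top at_top"
    proof (rule filterlim_at_top_mono)
      show "\<forall>\<^sub>F L in at_top. inverse (3 + sqrt 8) * ?c L \<le> ratio lam \<xi> L"
      proof (rule eventually_mono[OF eventually_gt_at_top[of 0]])
        fix L :: real assume "L > 0"
        from cayley_bounds(2)[OF \<xi> this, of lam] pos'
        show "inverse (3 + sqrt 8) * ?c L \<le> ratio lam \<xi> L"
          by (simp add: field_simps)
      qed
    qed
  qed
  then show ?thesis using filterlim_norm_product_iff[OF \<xi>] by simp
qed

text \<open>The denominator w is the distance from s to \<open>cnj \<xi>\<close>, and the numerator
  lies between 2 - w and 2. Hence the quotient blows up exactly when w tends to 0.\<close>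

lemma cayley_iff_schur:
  assumes \<xi>: "cmod \<xi> = 1"
  shows "filterlim (cayley lam \<xi>) at_top (at_right 0) \<longleftrightarrow>
    ((\<lambda>e. schur \<phi> (of_real lam + \<i> * of_real e)) \<longlongrightarrow> cnj \<xi>) (at_right 0)"
proof -
  define s where "s e = schur \<phi> (of_real lam + \<i> * of_real e)" for e :: real
  have \<xi>1: "\<xi> * cnj \<xi> = 1" using \<xi> by (simp add: complex_norm_square[symmetric])
  define w where "w e = cmod (1 - \<xi> * s e)" for e
  have s1: "cmod (\<xi> * s e) < 1" if "e > 0" for e
  proof -
    have "Im (of_real lam + \<i> * of_real e) > 0" using that by simp
    then show ?thesis
      unfolding norm_mult \<xi> s_def by (metis schur_weyl_solution mult_1)
  qed
  have w: "w e > 0" if "e > 0" for e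
    using norm_triangle_ineq2[of 1 "\<xi> * s e"] s1[OF that] unfolding w_def norm_one by linarith
  have cay: "cayley lam \<xi> e = cmod (1 + \<xi> * s e) / w e" for e
    by (simp add: cayley_def s_def w_def Let_def norm_divide)
  have "(s \<longlongrightarrow> cnj \<xi>) (at_right 0) \<longleftrightarrow> (w \<longlongrightarrow> 0) (at_right 0)"
  proof -
    have "w e = cmod (s e - cnj \<xi>)" for e
    proof -
      have "1 - \<xi> * s e = - (\<xi> * (s e - cnj \<xi>))" by (simp add: algebra_simps \<xi>1)
      then show ?thesis by (simp only: w_def norm_minus_cancel norm_mult \<xi> mult_1)
    qed
    then have "w = (\<lambda>e. norm (s e - cnj \<xi>))" by auto
    then show ?thesis
      using LIM_zero_iff[of s "cnj \<xi>"] by (simp add: tendsto_norm_zero_iff)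
  qed
  moreover have "filterlim (cayley lam \<xi>) at_top (at_right 0) \<longleftrightarrow> (w \<longlongrightarrow> 0) (at_right 0)"
  proof
    assume "(w \<longlongrightarrow> 0) (at_right 0)"
    then have "filterlim w (at_right 0) (at_right 0)"
      by (rule tendsto_imp_filterlim_at_right) (rule eventually_mono[OF eventually_at_right_less w])
    then have "filterlim (\<lambda>e. inverse (w e)) at_top (at_right 0)"
      using filterlim_compose[OF filterlim_inverse_at_top_right] by blast
    then have "filterlim (\<lambda>e. - 1 + 2 * inverse (w e)) at_top (at_right 0)"
      by (intro filterlim_tendsto_add_at_top[OF tendsto_const filterlim_tendsto_pos_mult_at_top[OF tendsto_const]]) simp
    then show "filterlim (cayley lam \<xi>) at_top (at_right 0)"
    proof (rule filterlim_at_top_mono)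
      show "\<forall>\<^sub>F e in at_right 0. - 1 + 2 * inverse (w e) \<le> cayley lam \<xi> e"
      proof (rule eventually_mono[OF eventually_at_right_less])
        fix e :: real assume "0 < e"
        have "2 - w e \<le> cmod (1 + \<xi> * s e)"
          using norm_triangle_ineq2[of 2 "1 - \<xi> * s e"] by (simp add: w_def)
        then have "(2 - w e) / w e \<le> cayley lam \<xi> e"
          unfolding cay using w[OF \<open>0 < e\<close>] by (intro divide_right_mono) auto
        moreover have "(2 - w e) / w e = - 1 + 2 * inverse (w e)"
          using w[OF \<open>0 < e\<close>] by (simp add: field_simps)
        ultimately show "- 1 + 2 * inverse (w e) \<le> cayley lam \<xi> e" by simp
      qed
    qed
  next
    assume "filterlim (cayley lam \<xi>) at_top (at_right 0)"
    then have "((\<lambda>e. inverse (cayley lam \<xi> e)) \<longlongrightarrow> 0) (at_right 0)"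
      by (rule tendsto_inverse_0_at_top)
    from tendsto_mult[OF tendsto_const[of 2] this]
    have lim: "((\<lambda>e. 2 * inverse (cayley lam \<xi> e)) \<longlongrightarrow> 0) (at_right 0)" by simp
    have pos: "\<forall>\<^sub>F e in at_right 0. cayley lam \<xi> e > 0"
      using \<open>filterlim (cayley lam \<xi>) at_top (at_right 0)\<close> by (simp add: filterlim_at_top_dense)
    show "(w \<longlongrightarrow> 0) (at_right 0)"
    proof (rule tendsto_sandwich[OF _ _ tendsto_const lim])
      show "\<forall>\<^sub>F e in at_right 0. 0 \<le> w e" by (simp add: w_def)
      show "\<forall>\<^sub>F e in at_right 0. w e \<le> 2 * inverse (cayley lam \<xi> e)"
        using pos eventually_at_right_less[of 0]
      proof eventually_elim
        case (elim e)
        have "cmod (1 + \<xi> * s e) \<le> 2"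
          using norm_triangle_ineq[of 1 "\<xi> * s e"] s1[OF elim(2)] by simp
        then have "cayley lam \<xi> e * w e \<le> 2" using w[OF elim(2)] by (simp add: cay)
        then show ?case using elim(1) by (simp add: field_simps)
      qed
    qed
  qed
  ultimately show ?thesis by (simp add: s_def[abs_def])
qed

section \<open>Subordinacy as divergence of the ratio of norms\<close>

lemma normL_boundary_sol:
  assumes "cmod \<eta> = 1"
  shows "normL L (sol \<phi> (of_real lam) (1, \<eta>)) = sqrt 2 * normL L (fst_sol lam \<eta>)"
proof -
  \<comment> \<open>Both components have equal modulus; the resulting factor cancels in ratios of
    norms.\<close>
  have "(\<lambda>x. (norm (sol \<phi> (of_real lam) (1, \<eta>) x))\<^sup>2) = (\<lambda>x. 2 * (cmod (fst_sol lam \<eta> x))\<^sup>2)"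
    by (simp add: sol_boundary[OF assms] norm_pair_sq norm_mult assms)
  then show ?thesis by (simp add: normL_def real_sqrt_mult)
qed

text \<open>Subordinacy of W only has to be tested against V, the solution from (1, - \<xi>). Any
  independent U is a W + b V with b nonzero, so b V = U - a W bounds the norm of U from below in
  terms of those of V and W.\<close>

lemma subordinate_iff_ratio:
  assumes \<xi>: "cmod \<xi> = 1"
  shows "subordinate \<phi> lam (sol \<phi> (of_real lam) (1, \<xi>)) \<longleftrightarrow> filterlim (ratio lam \<xi>) at_top at_top"
proof -
  define W V where "W = sol \<phi> (of_real lam) (1, \<xi>)" and "V = sol \<phi> (of_real lam) (1, - \<xi>)"
  have \<xi>': "cmod (- \<xi>) = 1" and "\<xi> \<noteq> 0" using \<xi> by auto
  have nW: "normL L W = sqrt 2 * normL L (fst_sol lam \<xi>)" and nV: "normL L V = sqrt 2 * normL L (fst_sol lam (- \<xi>))" for L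
    by (simp_all only: W_def V_def normL_boundary_sol[OF \<xi>] normL_boundary_sol[OF \<xi>'])
  have WV0: "W 0 = (1, \<xi>)" "V 0 = (1, - \<xi>)" by (simp_all add: W_def V_def sol_0)
  have solWV: "is_sol \<phi> (of_real lam) W" "is_sol \<phi> (of_real lam) V" by (simp_all add: W_def V_def sol_is_sol)
  show ?thesis
    unfolding W_def[symmetric]
  proof
    assume sub: "subordinate \<phi> lam W"
    have "lin_indep_sol V W"
      unfolding lin_indep_sol_def
    proof (intro allI impI)
      fix a b :: complex
      assume "\<forall>x\<ge>0. a * fst (V x) + b * fst (W x) = 0 \<and> a * snd (V x) + b * snd (W x) = 0"
      then have "a * fst (V 0) + b * fst (W 0) = 0 \<and> a * snd (V 0) + b * snd (W 0) = 0" by blast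
      then have "a + b = 0" "\<xi> * (b - a) = 0" by (simp_all add: WV0 algebra_simps)
      then show "a = 0 \<and> b = 0" using \<open>\<xi> \<noteq> 0\<close> by (auto simp: add_eq_0_iff)
    qed
    then have "filterlim (\<lambda>L. normL L V / normL L W) at_top at_top"
      using sub solWV by (simp add: subordinate_def)
    then show "filterlim (ratio lam \<xi>) at_top at_top"
      by (simp add: nW nV ratio_def[abs_def])
  next
    assume lim: "filterlim (ratio lam \<xi>) at_top at_top"
    show "subordinate \<phi> lam W"
      unfolding subordinate_def
    proof (intro conjI allI impI; (elim conjE)?)
      fix U assume U: "is_sol \<phi> (of_real lam) U" and indep: "lin_indep_sol U W"
      define a b where "a = (fst (U 0) + cnj \<xi> * snd (U 0)) / 2" and "b = (fst (U 0) - cnj \<xi> * snd (U 0)) / 2"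
      have \<xi>1: "\<xi> * cnj \<xi> = 1" using \<xi> by (simp add: complex_norm_square[symmetric])
      have "U 0 = (a * 1 + b * 1, a * \<xi> + b * (- \<xi>))"
        using \<xi>1 by (simp add: a_def b_def prod_eq_iff field_simps)
      then have dec: "U x = (a * fst (W x) + b * fst (V x), a * snd (W x) + b * snd (V x))" for x
        using sol_unique[OF U] sol_linear[of "of_real lam" a 1 b 1 \<xi> "- \<xi>" x] by (simp add: W_def V_def)
      have "b \<noteq> 0"
      proof
        assume "b = 0"
        then have "\<forall>x\<ge>0. 1 * fst (U x) + (- a) * fst (W x) = 0 \<and> 1 * snd (U x) + (- a) * snd (W x) = 0"
          by (simp add: dec)
        then have "(1::complex) = 0" using indep unfolding lin_indep_sol_def by blast
        then show False by simp
      qed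
      have lower: "(cmod b)\<^sup>2 / 2 * (ratio lam \<xi> L)\<^sup>2 - (cmod a)\<^sup>2 \<le> (normL L U / normL L W)\<^sup>2" if "L > 0" for L
      proof -
        note c = continuous_on_is_sol[OF U] continuous_on_is_sol[OF solWV(1)] continuous_on_is_sol[OF solWV(2)]
        have "integral {0..L} (\<lambda>x. (cmod b)\<^sup>2 * (norm (V x))\<^sup>2)
            \<le> integral {0..L} (\<lambda>x. 2 * (norm (U x))\<^sup>2 + 2 * (cmod a)\<^sup>2 * (norm (W x))\<^sup>2)"
        proof (rule integral_le)
          fix x
          have "(cmod b)\<^sup>2 * (norm (V x))\<^sup>2 = (norm (b * fst (V x), b * snd (V x)))\<^sup>2"
            by (simp add: norm_pair_sq norm_mult power_mult_distrib algebra_simps)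
          also have "(b * fst (V x), b * snd (V x)) = U x + (- a * fst (W x), - a * snd (W x))"
            by (simp add: dec)
          also have "(norm \<dots>)\<^sup>2 \<le> 2 * (norm (U x))\<^sup>2 + 2 * (norm (- a * fst (W x), - a * snd (W x)))\<^sup>2"
            by (rule norm_add_sq_le)
          also have "(norm (- a * fst (W x), - a * snd (W x)))\<^sup>2 = (cmod a)\<^sup>2 * (norm (W x))\<^sup>2"
            by (simp add: norm_pair_sq norm_mult power_mult_distrib algebra_simps)
          finally show "(cmod b)\<^sup>2 * (norm (V x))\<^sup>2 \<le> 2 * (norm (U x))\<^sup>2 + 2 * (cmod a)\<^sup>2 * (norm (W x))\<^sup>2" by simp
        qed (intro integrable_continuous_real continuous_intros c)+
        also have "\<dots> = 2 * (normL L U)\<^sup>2 + 2 * (cmod a)\<^sup>2 * (normL L W)\<^sup>2"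
          unfolding normL_sq[OF c(1)] normL_sq[OF c(2)]
          by (subst integral_add) (auto intro!: integrable_continuous_real continuous_intros c)
        finally have le: "(cmod b)\<^sup>2 * (normL L V)\<^sup>2 \<le> 2 * (normL L U)\<^sup>2 + 2 * (cmod a)\<^sup>2 * (normL L W)\<^sup>2"
          unfolding normL_sq[OF c(3)] by simp
        have W: "normL L W > 0" using that by (simp add: nW normL_fst_sol_pos)
        have "normL L V = ratio lam \<xi> L * normL L W"
          using normL_fst_sol_pos[OF that, of lam \<xi>] by (simp add: ratio_def nW nV)
        then have "((cmod b)\<^sup>2 / 2 * (ratio lam \<xi> L)\<^sup>2 - (cmod a)\<^sup>2) * (normL L W)\<^sup>2 \<le> (normL L U)\<^sup>2"
          using le by (simp add: power_mult_distrib algebra_simps)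
        then show ?thesis unfolding power_divide using W by (subst pos_le_divide_eq) auto
      qed
      have "filterlim (\<lambda>L. - (cmod a)\<^sup>2 + (cmod b)\<^sup>2 / 2 * (ratio lam \<xi> L)\<^sup>2) at_top at_top"
        using \<open>b \<noteq> 0\<close> by (intro filterlim_tendsto_add_at_top[OF tendsto_const
            filterlim_tendsto_pos_mult_at_top[OF tendsto_const _ filterlim_pow_at_top[OF _ lim]]]) simp_all
      then have "filterlim (\<lambda>L. (normL L U / normL L W)\<^sup>2) at_top at_top"
      proof (rule filterlim_at_top_mono)
        show "\<forall>\<^sub>F L in at_top. - (cmod a)\<^sup>2 + (cmod b)\<^sup>2 / 2 * (ratio lam \<xi> L)\<^sup>2 \<le> (normL L U / normL L W)\<^sup>2"
          by (rule eventually_mono[OF eventually_gt_at_top[of 0]]) (use lower in force)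
      qed
      then have "filterlim (\<lambda>L. sqrt ((normL L U / normL L W)\<^sup>2)) at_top at_top"
        by (rule filterlim_compose[OF sqrt_at_top])
      moreover have "sqrt ((normL L U / normL L W)\<^sup>2) = normL L U / normL L W" for L
        by (simp add: normL_nonneg continuous_on_is_sol[OF U] continuous_on_is_sol[OF solWV(1)])
      ultimately show "filterlim (\<lambda>L. normL L U / normL L W) at_top at_top" by simp
    qed (rule solWV)
  qed
qed

end

theorem theorem3p1:
  fixes \<phi> :: "real \<Rightarrow> complex" and lam :: real
  assumes loc: "\<And>x. \<phi> absolutely_integrable_on {0..x}"
    and unif: "\<exists>C. \<forall>x\<ge>0. integral {x..x+1} (\<lambda>t. cmod (\<phi> t)) \<le> C"
  defines "cm \<equiv> 3 - sqrt 8" and "cp \<equiv> 3 + sqrt 8"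
  defines "eps \<equiv> (\<lambda>\<xi> L. 1 / (2 * normL L (\<lambda>x. Aent \<phi> lam x + \<xi> * Bent \<phi> lam x)
                                * normL L (\<lambda>x. Aent \<phi> lam x - \<xi> * Bent \<phi> lam x)))"
  shows "(\<forall>\<xi> L. cmod \<xi> = 1 \<and> L > 0 \<longrightarrow>
            (let r = normL L (\<lambda>x. Aent \<phi> lam x - \<xi> * Bent \<phi> lam x)
                     / normL L (\<lambda>x. Aent \<phi> lam x + \<xi> * Bent \<phi> lam x);
                 s = schur \<phi> (complex_of_real lam + \<i> * complex_of_real (eps \<xi> L));
                 q = cmod ((1 + \<xi> * s) / (1 - \<xi> * s))
             in cm * r \<le> q \<and> q \<le> cp * r))
       \<and> (\<forall>\<xi>. cmod \<xi> = 1 \<longrightarrow>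
            (((\<lambda>e. schur \<phi> (complex_of_real lam + \<i> * complex_of_real e)) \<longlongrightarrow> cnj \<xi>) (at_right 0)
             \<longleftrightarrow> subordinate \<phi> lam (sol \<phi> (complex_of_real lam) (1, \<xi>))))"
proof -
  interpret dirac_system \<phi> by unfold_locales (rule loc)
  have fst_sol: "(\<lambda>x. Aent \<phi> lam x + \<xi> * Bent \<phi> lam x) = fst_sol lam \<xi>"
    "(\<lambda>x. Aent \<phi> lam x - \<xi> * Bent \<phi> lam x) = fst_sol lam (- \<xi>)" for \<xi>
    by (simp_all add: fun_eq_iff fst_sol_eq)
  show ?thesis
    unfolding eps_def cm_def cp_def fst_sol Let_def
    using schur_ratio_bounds[of _ _ lam] subordinate_iff_ratio[of _ lam]
      ratio_iff_cayley[of _ lam] cayley_iff_schur[of _ lam]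
    by blast
qed

end
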